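(* $\textsc{Min-Exp}~\mathcal{P}$ with uncertain due dates is polynomially solvable when $\mathcal{P}\in\{1|p_j=1|\sum w_jU_j,\;1|p_j=1|\sum w_jT_j\}$.
   Context: Single machine scheduling: a set $J$ of $n$ jobs with unit processing times and deterministic nonnegative weights $w_j$; a schedule $\pi$ is a permutation of $J$ processed without idle time from time 0, with completion times $C_j(\pi)$. A scenario set $\mathcal{U}=\{\xi_1,\dots,\xi_K\}$ (part of the input) specifies nonnegative due dates $d_j(\xi)$, with probabilities ${\rm Pr}[\xi_i]>0$ summing to 1. $T_j(\pi,\xi)=\max\{0,C_j(\pi)-d_j(\xi)\}$, $U_j(\pi,\xi)=1$ if $C_j(\pi)>d_j(\xi)$ else $0$. The cost $f(\pi,\xi)$ is $\sum_jw_jU_j(\pi,\xi)$ or $\sum_jw_jT_j(\pi,\xi)$ respectively. $\textsc{Min-Exp}~\mathcal{P}$: minimize $\sum_i{\rm Pr}[\xi_i]f(\pi,\xi_i)$ over all schedules. *)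

theory Defs
  imports
    "HOL-Computational_Algebra.Polynomial"
    "HOL-Combinatorics.Multiset_Permutations"
    "HOL-Library.Log_Nat"
begin

section \<open>Polynomial time: a random access machine with logarithmic cost\<close>

text \<open>
  The machine model is the random access machine under the logarithmic cost criterion
  (Aho, Hopcroft, Ullman), which is polynomially related to Turing machines. Programs are
  structured instead of flat lists with jumps, and the memory is divided into arrays.
  A program names its arrays by constants, so it uses finitely many of them; a
  scalar variable is a cell with a fixed index.
\<close>

text \<open>Sign bit plus binary digits of the absolute value.\<close>

definition int_size :: "int \<Rightarrow> nat" where
  "int_size k = floorlog 2 (nat \<bar>k\<bar>) + 1"

type_synonym store = "nat \<Rightarrow> int \<Rightarrow> int"

datatype aexp =
    Const int
  | Cell nat aexp
  | Add aexp aexp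
  | Sub aexp aexp
  | Mul aexp aexp

datatype bexp =
    Less aexp aexp
  | Neg bexp
  | Conj bexp bexp

datatype com =
    Skip
  | Assign nat aexp aexp
  | Seq com com
  | Cond bexp com com
  | While bexp com

fun aval :: "aexp \<Rightarrow> store \<Rightarrow> int" where
  "aval (Const k) s = k"
| "aval (Cell x a) s = s x (aval a s)"
| "aval (Add a b) s = aval a s + aval b s"
| "aval (Sub a b) s = aval a s - aval b s"
| "aval (Mul a b) s = aval a s * aval b s"

fun bval :: "bexp \<Rightarrow> store \<Rightarrow> bool" where
  "bval (Less a b) s \<longleftrightarrow> aval a s < aval b s"
| "bval (Neg b) s \<longleftrightarrow> \<not> bval b s"
| "bval (Conj b c) s \<longleftrightarrow> bval b s \<and> bval c s"

text \<open>
  Logarithmic cost: an operation is charged the sizes of its operands, a memory access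
  the sizes of the address and of the contents of the cell.
\<close>

fun acost :: "aexp \<Rightarrow> store \<Rightarrow> nat" where
  "acost (Const k) s = int_size k"
| "acost (Cell x a) s = acost a s + int_size (aval a s) + int_size (s x (aval a s))"
| "acost (Add a b) s = acost a s + acost b s + int_size (aval a s) + int_size (aval b s)"
| "acost (Sub a b) s = acost a s + acost b s + int_size (aval a s) + int_size (aval b s)"
| "acost (Mul a b) s = acost a s + acost b s + int_size (aval a s) + int_size (aval b s)"

fun bcost :: "bexp \<Rightarrow> store \<Rightarrow> nat" where
  "bcost (Less a b) s = acost a s + acost b s + int_size (aval a s) + int_size (aval b s)"
| "bcost (Neg b) s = bcost b s + 1"
| "bcost (Conj b c) s = bcost b s + bcost c s + 1"

definition upd :: "store \<Rightarrow> nat \<Rightarrow> int \<Rightarrow> int \<Rightarrow> store" where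
  "upd s x i v = s(x := (s x)(i := v))"

text \<open>\<open>exec c s t s'\<close>: started in \<open>s\<close>, program \<open>c\<close> halts in \<open>s'\<close> after time \<open>t\<close>.\<close>

inductive exec :: "com \<Rightarrow> store \<Rightarrow> nat \<Rightarrow> store \<Rightarrow> bool" where
  Skip: "exec Skip s 1 s"
| Assign: "exec (Assign x a e) s
    (acost a s + acost e s + int_size (aval a s) + int_size (aval e s))
    (upd s x (aval a s) (aval e s))"
| Seq: "exec c s t s' \<Longrightarrow> exec d s' u s'' \<Longrightarrow> exec (Seq c d) s (t + u) s''"
| Cond_True: "bval b s \<Longrightarrow> exec c s t s' \<Longrightarrow> exec (Cond b c d) s (bcost b s + t) s'"
| Cond_False: "\<not> bval b s \<Longrightarrow> exec d s t s' \<Longrightarrow> exec (Cond b c d) s (bcost b s + t) s'"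
| While_False: "\<not> bval b s \<Longrightarrow> exec (While b c) s (bcost b s) s"
| While_True: "bval b s \<Longrightarrow> exec c s t s' \<Longrightarrow> exec (While b c) s' u s'' \<Longrightarrow>
    exec (While b c) s (bcost b s + t + u) s''"

lemma exec_deterministic:
  "exec c s t s' \<Longrightarrow> exec c s u s'' \<Longrightarrow> u = t \<and> s'' = s'"
proof (induction arbitrary: u s'' rule: exec.induct)
  case (While_True b s c t s' v s3)
  from While_True.prems While_True.hyps(1) obtain t' s1 v' where
    "exec c s t' s1" "exec (While b c) s1 v' s''" "u = bcost b s + t' + v'"
    by (cases rule: exec.cases) auto
  with While_True.IH show ?case by blast
next
  case (Seq c s t s1 d v s2)
  from Seq.prems obtain t' s3 v' where
    "exec c s t' s3" "exec d s3 v' s''" "u = t' + v'"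
    by (cases rule: exec.cases) auto
  with Seq.IH show ?case by blast
qed (erule exec.cases; fastforce)+

text \<open>The input is in array 0, the output in array 1; cell 0 of each holds the length.\<close>

definition input_store :: "int list \<Rightarrow> store" where
  "input_store xs = (\<lambda>x i.
     if x = 0 \<and> i = 0 then int (length xs)
     else if x = 0 \<and> 1 \<le> i \<and> i \<le> int (length xs) then xs ! nat (i - 1)
     else 0)"

definition has_output :: "store \<Rightarrow> int list \<Rightarrow> bool" where
  "has_output s ys \<longleftrightarrow> s 1 0 = int (length ys) \<and> (\<forall>i<length ys. s 1 (int i + 1) = ys ! i)"

definition input_size :: "int list \<Rightarrow> nat" where
  "input_size xs = sum_list (map int_size xs)"

text \<open>
  A search problem is given by its set of instances, a relation between instances and
  correct answers, and encodings of both as integer sequences.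
\<close>

definition polynomially_solvable ::
  "'i set \<Rightarrow> ('i \<Rightarrow> 'o \<Rightarrow> bool) \<Rightarrow> ('i \<Rightarrow> int list) \<Rightarrow> ('o \<Rightarrow> int list) \<Rightarrow> bool" where
  "polynomially_solvable Is sol enc_in enc_out \<longleftrightarrow>
     (\<exists>(c :: com) (p :: nat poly). \<forall>I\<in>Is. \<exists>t s y.
        exec c (input_store (enc_in I)) t s \<and>
        t \<le> poly p (input_size (enc_in I)) \<and>
        has_output s (enc_out y) \<and> sol I y)"


section \<open>Scheduling unit jobs with uncertain due dates\<close>

text \<open>
  Jobs are \<open>0, \<dots>, njobs - 1\<close>, scenarios are \<open>0, \<dots>, nscen - 1\<close>;
  \<open>due I i j\<close> is the due date of job \<open>j\<close> under scenario \<open>i\<close>.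
  The values of the functions outside these ranges are irrelevant.
\<close>

record sched_inst =
  njobs :: nat
  nscen :: nat
  weight :: "nat \<Rightarrow> rat"
  prob :: "nat \<Rightarrow> rat"
  due :: "nat \<Rightarrow> nat \<Rightarrow> rat"

definition sched_instances :: "sched_inst set" where
  "sched_instances = {I.
     (\<forall>j<njobs I. 0 \<le> weight I j) \<and>
     (\<forall>i<nscen I. \<forall>j<njobs I. 0 \<le> due I i j) \<and>
     (\<forall>i<nscen I. 0 < prob I i) \<and>
     (\<Sum>i<nscen I. prob I i) = 1}"

definition schedules :: "sched_inst \<Rightarrow> nat list set" where
  "schedules I = permutations_of_set {..<njobs I}"

definition proc_time :: "nat \<Rightarrow> rat" where
  "proc_time j = 1"

definition completion :: "nat list \<Rightarrow> nat \<Rightarrow> rat" where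
  "completion \<pi> j = (\<Sum>i\<leftarrow>takeWhile (\<lambda>i. i \<noteq> j) \<pi>. proc_time i) + proc_time j"

definition tardiness :: "sched_inst \<Rightarrow> nat list \<Rightarrow> nat \<Rightarrow> nat \<Rightarrow> rat" where
  "tardiness I \<pi> i j = max 0 (completion \<pi> j - due I i j)"

definition unit_penalty :: "sched_inst \<Rightarrow> nat list \<Rightarrow> nat \<Rightarrow> nat \<Rightarrow> rat" where
  "unit_penalty I \<pi> i j = (if completion \<pi> j > due I i j then 1 else 0)"

definition sum_wU :: "sched_inst \<Rightarrow> nat list \<Rightarrow> nat \<Rightarrow> rat" where
  "sum_wU I \<pi> i = (\<Sum>j<njobs I. weight I j * unit_penalty I \<pi> i j)"

definition sum_wT :: "sched_inst \<Rightarrow> nat list \<Rightarrow> nat \<Rightarrow> rat" where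
  "sum_wT I \<pi> i = (\<Sum>j<njobs I. weight I j * tardiness I \<pi> i j)"

definition expected_cost ::
  "(sched_inst \<Rightarrow> nat list \<Rightarrow> nat \<Rightarrow> rat) \<Rightarrow> sched_inst \<Rightarrow> nat list \<Rightarrow> rat" where
  "expected_cost f I \<pi> = (\<Sum>i<nscen I. prob I i * f I \<pi> i)"

definition min_exp ::
  "(sched_inst \<Rightarrow> nat list \<Rightarrow> nat \<Rightarrow> rat) \<Rightarrow> sched_inst \<Rightarrow> nat list \<Rightarrow> bool" where
  "min_exp f I \<pi> \<longleftrightarrow> is_arg_min (expected_cost f I) (\<lambda>\<sigma>. \<sigma> \<in> schedules I) \<pi>"

text \<open>Rationals are encoded as numerator and positive denominator in lowest terms.\<close>

definition encode_rat :: "rat \<Rightarrow> int list" where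
  "encode_rat q = [fst (quotient_of q), snd (quotient_of q)]"

definition encode_inst :: "sched_inst \<Rightarrow> int list" where
  "encode_inst I = [int (njobs I), int (nscen I)]
     @ concat (map (\<lambda>j. encode_rat (weight I j)) [0..<njobs I])
     @ concat (map (\<lambda>i. encode_rat (prob I i)) [0..<nscen I])
     @ concat (map (\<lambda>i. concat (map (\<lambda>j. encode_rat (due I i j)) [0..<njobs I])) [0..<nscen I])"

definition encode_schedule :: "nat list \<Rightarrow> int list" where
  "encode_schedule \<pi> = map int \<pi>"

end

theory Submission
  imports Defs
begin

text \<open>
  With unit processing times the job in position \<open>t\<close> completes at time \<open>t + 1\<close>, so the expected
  cost is a sum over positions of a cost depending only on the position and the job placed there:
  an optimal schedule is a minimum cost assignment of jobs to positions. After scaling by the common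
  denominator the cost matrix is integral, with entries of length linear in the input size. The
  assignment problem is solved by the Hungarian method: dual potentials stay feasible, matched edges
  stay tight, and once all rows are matched, weak duality gives optimality. There are at most
  \<open>(n + 1)\<^sup>2\<close> tree steps, and potentials never exceed the largest cost.
\<close>

section \<open>A weakest precondition calculus with time bounds\<close>

text \<open>Under logarithmic cost, polynomial time needs both few iterations and short numbers. The
  time bookkeeping is separated from both. If every cell stays within \<open>L\<close> in absolute
  value and every activation of a loop makes at most \<open>N\<close> iterations, the time is
  bounded by an expression in \<open>N\<close> and \<open>int_size L\<close> that is read off the
  program text, and this is polynomial because the program is fixed. What remains are invariants;
  the price is that every assignment carries the obligation that the stored value stays within
  \<open>L\<close>. The form of the Hungarian method is chosen for simple invariants. Rows are
  positions and columns are jobs. Each step scans the whole matrix for the least slack between a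
  tree row and a column outside the tree, and shifts the potentials by it (possibly by 0), so dual
  adjustment and tree extension are one operation. It then copies a whole matching. This is
  wasteful, but every loop except the outermost is a counted one, and growing and augmenting share
  all code up to the labelling.\<close>

fun value_weight :: "aexp \<Rightarrow> nat" where
  "value_weight (Const k) = int_size k"
| "value_weight (Cell x a) = 1"
| "value_weight (Add a b) = value_weight a + value_weight b"
| "value_weight (Sub a b) = value_weight a + value_weight b"
| "value_weight (Mul a b) = value_weight a + value_weight b"

text \<open>Both weights multiply a bound \<open>B\<close> on the size of every cell:
  \<open>value_weight a * B\<close> bounds the size of the value, \<open>aexp_weight a * B\<close>
  the cost. A cell access resets the value weight to 1, and a product is no longer than its factors
  together, so the coefficients depend on the expression alone.\<close>

fun aexp_weight :: "aexp \<Rightarrow> nat" where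
  "aexp_weight (Const k) = int_size k"
| "aexp_weight (Cell x a) = aexp_weight a + value_weight a + 1"
| "aexp_weight (Add a b) = aexp_weight a + aexp_weight b + value_weight a + value_weight b"
| "aexp_weight (Sub a b) = aexp_weight a + aexp_weight b + value_weight a + value_weight b"
| "aexp_weight (Mul a b) = aexp_weight a + aexp_weight b + value_weight a + value_weight b"

fun bexp_weight :: "bexp \<Rightarrow> nat" where
  "bexp_weight (Less a b) = aexp_weight a + aexp_weight b + value_weight a + value_weight b"
| "bexp_weight (Neg b) = bexp_weight b + 1"
| "bexp_weight (Conj b c) = bexp_weight b + bexp_weight c + 1"

text \<open>Made independent of the store: a conditional pays for both branches, a loop for
  \<open>N\<close> rounds and the final failing test.\<close>

fun time_bound :: "nat \<Rightarrow> nat \<Rightarrow> com \<Rightarrow> nat" where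
  "time_bound N B Skip = 1"
| "time_bound N B (Assign x a e) =
     (aexp_weight a + aexp_weight e + value_weight a + value_weight e) * B"
| "time_bound N B (Seq c d) = time_bound N B c + time_bound N B d"
| "time_bound N B (Cond b c d) = bexp_weight b * B + time_bound N B c + time_bound N B d"
| "time_bound N B (While b c) = bexp_weight b * B + N * (bexp_weight b * B + time_bound N B c)"

text \<open>Every level of loop nesting multiplies by \<open>p\<close> once, so the degree is fixed
  by the program.\<close>

lemma time_bound_poly: "\<exists>r. \<forall>z. time_bound (poly p z) (poly q z) c = poly r z"
proof (induction c)
  case Skip
  show ?case by (rule exI[of _ 1]) simp
next
  case (Assign x a e)
  show ?case
    by (rule exI[of _ "smult (aexp_weight a + aexp_weight e + value_weight a + value_weight e) q"]) simp
next
  case (Seq c d)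
  then obtain r1 r2 where "\<forall>z. time_bound (poly p z) (poly q z) c = poly r1 z"
    "\<forall>z. time_bound (poly p z) (poly q z) d = poly r2 z" by blast
  then show ?case by (intro exI[of _ "r1 + r2"]) simp
next
  case (Cond b c d)
  then obtain r1 r2 where "\<forall>z. time_bound (poly p z) (poly q z) c = poly r1 z"
    "\<forall>z. time_bound (poly p z) (poly q z) d = poly r2 z" by blast
  then show ?case by (intro exI[of _ "smult (bexp_weight b) q + r1 + r2"]) simp
next
  case (While b c)
  then obtain r where "\<forall>z. time_bound (poly p z) (poly q z) c = poly r z" by blast
  then show ?case
    by (intro exI[of _ "smult (bexp_weight b) q + p * (smult (bexp_weight b) q + r)"]) simp
qed

section \<open>Sizes of integers under addition and multiplication\<close>

lemma int_size_pos: "1 \<le> int_size k"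
  by (simp add: int_size_def)

text \<open>The \<open>Suc\<close> is the sign bit.\<close>

lemma int_size_le_iff: "int_size k \<le> Suc b \<longleftrightarrow> \<bar>k\<bar> < 2 ^ b"
proof -
  have "int_size k \<le> Suc b \<longleftrightarrow> nat \<bar>k\<bar> < 2 ^ b"
    by (simp add: int_size_def floorlog_le_iff)
  also have "\<dots> \<longleftrightarrow> \<bar>k\<bar> < 2 ^ b" by (simp add: nat_less_iff)
  finally show ?thesis .
qed

lemma abs_less_int_size: "\<bar>k\<bar> < 2 ^ (int_size k - 1)"
  using int_size_le_iff[of k "int_size k - 1"] int_size_pos[of k] by simp

lemma abs_le_int_size: "\<bar>k\<bar> \<le> 2 ^ int_size k"
proof -
  have "(2::int) ^ (int_size k - 1) \<le> 2 ^ int_size k" by (intro power_increasing) auto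
  with abs_less_int_size[of k] show ?thesis by linarith
qed

lemma int_size_mono: "\<bar>k\<bar> \<le> \<bar>l\<bar> \<Longrightarrow> int_size k \<le> int_size l"
  using int_size_le_iff[of k "int_size l - 1"] abs_less_int_size[of l] int_size_pos[of l] by simp

text \<open>The sum of the sizes, rather than the maximum plus one, fits the additive weights. It
  suffices because no size is 0: \<open>2 ^ a + 2 ^ b \<le> 2 ^ Suc (a + b)\<close>, while the two
  sizes add up to \<open>a + b + 2\<close>.\<close>

lemma int_size_add_le: "\<bar>k\<bar> \<le> \<bar>x\<bar> + \<bar>y\<bar> \<Longrightarrow> int_size k \<le> int_size x + int_size y"
proof -
  assume k: "\<bar>k\<bar> \<le> \<bar>x\<bar> + \<bar>y\<bar>"
  obtain a b where ab: "int_size x = Suc a" "int_size y = Suc b"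
    using int_size_pos[of x] int_size_pos[of y] by (metis One_nat_def Suc_le_D)
  have "\<bar>x\<bar> < 2 ^ a" "\<bar>y\<bar> < 2 ^ b"
    using abs_less_int_size[of x] abs_less_int_size[of y] ab by simp_all
  moreover have "(2::int) ^ a \<le> 2 ^ (a + b)" "(2::int) ^ b \<le> 2 ^ (a + b)"
    by (intro power_increasing; simp)+
  ultimately have "\<bar>k\<bar> < 2 ^ Suc (a + b)" using k unfolding power_Suc by linarith
  then show ?thesis using int_size_le_iff[of k "Suc (a + b)"] ab by simp
qed

lemma int_size_mult_le: "int_size (x * y) \<le> int_size x + int_size y"
proof -
  obtain a b where ab: "int_size x = Suc a" "int_size y = Suc b"
    using int_size_pos[of x] int_size_pos[of y] by (metis One_nat_def Suc_le_D)
  have "\<bar>x\<bar> < 2 ^ a" "\<bar>y\<bar> < 2 ^ b"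
    using abs_less_int_size[of x] abs_less_int_size[of y] ab by simp_all
  then have "\<bar>x * y\<bar> < 2 ^ (a + b)"
    by (simp add: abs_mult power_add mult_strict_mono')
  then show ?thesis using int_size_le_iff[of "x * y" "a + b"] ab by simp
qed

section \<open>Cost of evaluation and execution under a bound on all cells\<close>

definition bounded_store :: "int \<Rightarrow> store \<Rightarrow> bool" where
  "bounded_store L s \<longleftrightarrow> (\<forall>x i. \<bar>s x i\<bar> \<le> L)"

lemma bounded_store_int_size: "bounded_store L s \<Longrightarrow> int_size (s x i) \<le> int_size L"
  unfolding bounded_store_def using abs_ge_self order_trans by (intro int_size_mono) fast

lemma int_size_aval_le:
  assumes "bounded_store L s"
  shows "int_size (aval a s) \<le> value_weight a * int_size L"
proof (induction a)
  case (Const k)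
  show ?case using int_size_pos[of L] by simp
next
  case (Cell x a)
  show ?case using bounded_store_int_size[OF assms] by simp
next
  case (Add a b)
  have "int_size (aval a s + aval b s) \<le> int_size (aval a s) + int_size (aval b s)"
    by (intro int_size_add_le) linarith
  with Add show ?case by (simp add: add_mult_distrib)
next
  case (Sub a b)
  have "int_size (aval a s - aval b s) \<le> int_size (aval a s) + int_size (aval b s)"
    by (intro int_size_add_le) linarith
  with Sub show ?case by (simp add: add_mult_distrib)
next
  case (Mul a b)
  then show ?case
    using int_size_mult_le[of "aval a s" "aval b s"] by (simp add: add_mult_distrib)
qed

lemma acost_le:
  assumes "bounded_store L s"
  shows "acost a s \<le> aexp_weight a * int_size L"
proof (induction a)
  case (Const k)
  show ?case using int_size_pos[of L] by simp
next
  case (Cell x a)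
  with int_size_aval_le[OF assms, of a] bounded_store_int_size[OF assms, of x "aval a s"]
  show ?case by (simp add: add_mult_distrib)
next
  case (Add a b)
  with int_size_aval_le[OF assms, of a] int_size_aval_le[OF assms, of b]
  show ?case by (simp add: add_mult_distrib)
next
  case (Sub a b)
  with int_size_aval_le[OF assms, of a] int_size_aval_le[OF assms, of b]
  show ?case by (simp add: add_mult_distrib)
next
  case (Mul a b)
  with int_size_aval_le[OF assms, of a] int_size_aval_le[OF assms, of b]
  show ?case by (simp add: add_mult_distrib)
qed

lemma bcost_le:
  assumes "bounded_store L s"
  shows "bcost b s \<le> bexp_weight b * int_size L"
proof (induction b)
  case (Less a b)
  with int_size_aval_le[OF assms, of a] int_size_aval_le[OF assms, of b]
    acost_le[OF assms, of a] acost_le[OF assms, of b]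
  show ?case by (simp add: add_mult_distrib)
next
  case (Neg b)
  with int_size_pos[of L] show ?case by (simp add: add_mult_distrib)
next
  case (Conj b c)
  with int_size_pos[of L] show ?case by (simp add: add_mult_distrib)
qed

fun modified :: "com \<Rightarrow> nat set" where
  "modified Skip = {}"
| "modified (Assign x a e) = {x}"
| "modified (Seq c d) = modified c \<union> modified d"
| "modified (Cond b c d) = modified c \<union> modified d"
| "modified (While b c) = modified c"

text \<open>Framing by whole arrays is purely syntactic, so simplification decides what survives a
  subprogram.\<close>

lemma exec_unmodified: "exec c s t s' \<Longrightarrow> x \<notin> modified c \<Longrightarrow> s' x = s x"
  by (induction rule: exec.induct) (auto simp: upd_def)

text \<open>
  \<open>wp N L c Q s\<close>: from \<open>s\<close>, if all its cells are at most \<open>L\<close> in absolute value, \<open>c\<close> reaches a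
  state satisfying \<open>Q\<close> with the same property; the time bound is the one obtained when no cell
  ever exceeds \<open>L\<close> and every activation of a loop makes at most \<open>N\<close> iterations.
\<close>

definition wp :: "nat \<Rightarrow> int \<Rightarrow> com \<Rightarrow> (store \<Rightarrow> bool) \<Rightarrow> store \<Rightarrow> bool" where
  "wp N L c Q s \<longleftrightarrow> (bounded_store L s \<longrightarrow>
     (\<exists>t s'. exec c s t s' \<and> t \<le> time_bound N (int_size L) c \<and> bounded_store L s' \<and> Q s'))"

lemma wpD:
  assumes "wp N L c Q s" "bounded_store L s"
  obtains t s' where "exec c s t s'" "t \<le> time_bound N (int_size L) c" "bounded_store L s'" "Q s'"
  using assms unfolding wp_def by blast

text \<open>The frame condition is added here once and for all, so that specifications need not list
  the untouched arrays.\<close>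

lemma wp_conseq:
  assumes "wp N L c P s"
    and "\<And>s'. bounded_store L s' \<Longrightarrow> \<forall>x. x \<notin> modified c \<longrightarrow> s' x = s x \<Longrightarrow> P s' \<Longrightarrow> Q s'"
  shows "wp N L c Q s"
  unfolding wp_def
proof
  assume "bounded_store L s"
  with assms(1) obtain t s' where s': "exec c s t s'" "t \<le> time_bound N (int_size L) c"
    "bounded_store L s'" "P s'" by (rule wpD)
  then have "Q s'" using exec_unmodified by (intro assms(2)) auto
  with s' show "\<exists>t s'. exec c s t s' \<and> t \<le> time_bound N (int_size L) c \<and> bounded_store L s' \<and> Q s'"
    by blast
qed

lemma wp_Skip: "Q s \<Longrightarrow> wp N L Skip Q s"
  unfolding wp_def using exec.Skip[of s] by (intro impI exI[of _ 1] exI[of _ s]) simp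

lemma wp_Assign:
  assumes "bounded_store L s \<Longrightarrow> \<bar>aval e s\<bar> \<le> L" and "Q (upd s x (aval a s) (aval e s))"
  shows "wp N L (Assign x a e) Q s"
  unfolding wp_def
proof (intro impI exI conjI)
  assume b: "bounded_store L s"
  show "exec (Assign x a e) s (acost a s + acost e s + int_size (aval a s) + int_size (aval e s))
    (upd s x (aval a s) (aval e s))" by (rule exec.Assign)
  show "acost a s + acost e s + int_size (aval a s) + int_size (aval e s)
    \<le> time_bound N (int_size L) (Assign x a e)"
    using acost_le[OF b, of a] acost_le[OF b, of e] int_size_aval_le[OF b, of a]
      int_size_aval_le[OF b, of e]
    by (simp add: add_mult_distrib)
  show "bounded_store L (upd s x (aval a s) (aval e s))"
    using b assms(1) by (simp add: bounded_store_def upd_def)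
qed (rule assms(2))

lemma wp_Seq:
  assumes "wp N L c (\<lambda>s'. wp N L d Q s') s"
  shows "wp N L (Seq c d) Q s"
  unfolding wp_def
proof
  assume "bounded_store L s"
  with assms obtain t s' where 1: "exec c s t s'" "t \<le> time_bound N (int_size L) c"
    and "bounded_store L s'" "wp N L d Q s'" by (rule wpD)
  then obtain u s'' where "exec d s' u s''" "u \<le> time_bound N (int_size L) d"
    "bounded_store L s''" "Q s''" using wpD by blast
  with 1 show "\<exists>t s'. exec (Seq c d) s t s' \<and> t \<le> time_bound N (int_size L) (Seq c d) \<and>
    bounded_store L s' \<and> Q s'"
    by (intro exI[of _ "t + u"] exI[of _ s'']) (auto intro: exec.Seq)
qed

lemma wp_Cond:
  assumes "bval b s \<Longrightarrow> wp N L c Q s" "\<not> bval b s \<Longrightarrow> wp N L d Q s"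
  shows "wp N L (Cond b c d) Q s"
  unfolding wp_def
proof
  assume bs: "bounded_store L s"
  show "\<exists>t s'. exec (Cond b c d) s t s' \<and> t \<le> time_bound N (int_size L) (Cond b c d) \<and>
    bounded_store L s' \<and> Q s'"
  proof (cases "bval b s")
    case True
    with assms(1) bs obtain t s' where "exec c s t s'" "t \<le> time_bound N (int_size L) c"
      "bounded_store L s'" "Q s'" using wpD by blast
    with True bcost_le[OF bs, of b] show ?thesis
      by (intro exI[of _ "bcost b s + t"] exI[of _ s']) (auto intro: exec.Cond_True)
  next
    case False
    with assms(2) bs obtain t s' where "exec d s t s'" "t \<le> time_bound N (int_size L) d"
      "bounded_store L s'" "Q s'" using wpD by blast
    with False bcost_le[OF bs, of b] show ?thesis
      by (intro exI[of _ "bcost b s + t"] exI[of _ s']) (auto intro: exec.Cond_False)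
  qed
qed

text \<open>The invariant is indexed by the variant \<open>m\<close>, which gives termination and
  also counts the rounds still to be paid for.\<close>

lemma wp_While:
  assumes init: "I m s" "m \<le> N"
    and step: "\<And>m s'. \<lbrakk>I m s'; bval b s'; bounded_store L s';
        \<forall>x. x \<notin> modified c \<longrightarrow> s' x = s x\<rbrakk> \<Longrightarrow> wp N L c (\<lambda>s''. \<exists>m'<m. I m' s'') s'"
    and final: "\<And>m s'. \<lbrakk>I m s'; \<not> bval b s'; bounded_store L s';
        \<forall>x. x \<notin> modified c \<longrightarrow> s' x = s x\<rbrakk> \<Longrightarrow> Q s'"
  shows "wp N L (While b c) Q s"
  unfolding wp_def
proof
  let ?B = "bexp_weight b * int_size L" and ?T = "time_bound N (int_size L) c"
  have *: "\<exists>t s''. exec (While b c) s' t s'' \<and> t \<le> ?B + m * (?B + ?T) \<and> bounded_store L s'' \<and> Q s''"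
    if "I m s'" "bounded_store L s'" "\<forall>x. x \<notin> modified c \<longrightarrow> s' x = s x" for m s'
    using that
  proof (induction m arbitrary: s' rule: less_induct)
    case (less m)
    note bc = bcost_le[OF less.prems(2), of b]
    show ?case
    proof (cases "bval b s'")
      case False
      with final less.prems bc show ?thesis
        by (intro exI[of _ "bcost b s'"] exI[of _ s']) (auto intro: exec.While_False)
    next
      case True
      from step[OF less.prems(1) True less.prems(2,3)] less.prems(2)
      obtain t s1 where 1: "exec c s' t s1" "t \<le> ?T" "bounded_store L s1"
        and "\<exists>m'<m. I m' s1" by (rule wpD)
      then obtain m' where m': "m' < m" "I m' s1" by blast
      have "\<forall>x. x \<notin> modified c \<longrightarrow> s1 x = s x"
        using exec_unmodified[OF 1(1)] less.prems(3) by simp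
      from less.IH[OF m' 1(3) this] obtain u s2 where
        2: "exec (While b c) s1 u s2" "u \<le> ?B + m' * (?B + ?T)" "bounded_store L s2" "Q s2"
        by blast
      \<comment> \<open>The drop from \<open>m\<close> to \<open>m'\<close> pays for the round just
        made.\<close>
      have "(m' + 1) * (?B + ?T) \<le> m * (?B + ?T)" using m'(1) by (intro mult_right_mono) auto
      then have "bcost b s' + t + u \<le> ?B + m * (?B + ?T)"
        using bc 1(2) 2(2) by (simp add: add_mult_distrib)
      then show ?thesis using exec.While_True[OF True 1(1) 2(1)] 2(3,4) by blast
    qed
  qed
  assume "bounded_store L s"
  from *[OF init(1) this] obtain t s'' where 1: "exec (While b c) s t s''"
    "t \<le> ?B + m * (?B + ?T)" "bounded_store L s''" "Q s''" by blast
  have "m * (?B + ?T) \<le> N * (?B + ?T)" using init(2) by (intro mult_right_mono) auto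
  then have "t \<le> time_bound N (int_size L) (While b c)"
    using 1(2) unfolding time_bound.simps by linarith
  with 1 show "\<exists>t s'. exec (While b c) s t s' \<and> t \<le> time_bound N (int_size L) (While b c) \<and>
    bounded_store L s' \<and> Q s'" by blast
qed

section \<open>Counted loops\<close>

abbreviation Var :: "nat \<Rightarrow> aexp" where
  "Var x \<equiv> Cell x (Const 0)"

definition For :: "nat \<Rightarrow> aexp \<Rightarrow> com \<Rightarrow> com" where
  "For x e c = Seq (Assign x (Const 0) (Const 0))
     (While (Less (Var x) e) (Seq c (Assign x (Const 0) (Add (Var x) (Const 1)))))"

lemma modified_For [simp]: "modified (For x e c) = insert x (modified c)"
  by (auto simp: For_def)

lemma upd_same [simp]: "upd s x i v x = (s x)(i := v)"
  by (simp add: upd_def)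

lemma upd_other [simp]: "y \<noteq> x \<Longrightarrow> upd s x i v y = s y"
  by (simp add: upd_def)

text \<open>The limit \<open>e\<close> is evaluated again before every round, so it must keep its
  value whenever only the counter and the arrays of the body may have changed. \<open>Ix\<close>
  makes the invariant blind to the counter, and \<open>int m \<le> L\<close> covers the counter's
  last value.\<close>

lemma wp_For:
  assumes x: "x \<notin> modified c" and m: "m \<le> N" "int m \<le> L"
    and e: "\<And>s'. \<forall>y. y \<notin> insert x (modified c) \<longrightarrow> s' y = s y \<Longrightarrow> aval e s' = int m"
    and I0: "I 0 s"
    and Ix: "\<And>i s' v. I i s' \<Longrightarrow> I i (upd s' x 0 v)"
    and step: "\<And>i s'. \<lbrakk>i < m; s' x 0 = int i; I i s'; bounded_store L s';
        \<forall>y. y \<notin> insert x (modified c) \<longrightarrow> s' y = s y\<rbrakk> \<Longrightarrow> wp N L c (I (Suc i)) s'"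
    and final: "\<And>s'. \<lbrakk>I m s'; bounded_store L s';
        \<forall>y. y \<notin> insert x (modified c) \<longrightarrow> s' y = s y\<rbrakk> \<Longrightarrow> Q s'"
  shows "wp N L (For x e c) Q s"
  unfolding For_def
proof (intro wp_Seq wp_Assign)
  show "\<bar>aval (Const 0) s\<bar> \<le> L" using m by simp
  let ?s = "upd s x (aval (Const 0) s) (aval (Const 0) s)"
  let ?J = "\<lambda>k s'. \<exists>i. k = m - i \<and> i \<le> m \<and> s' x 0 = int i \<and> I i s'"
  let ?c = "Seq c (Assign x (Const 0) (Add (Var x) (Const 1)))"
  have frame: "\<forall>y. y \<notin> insert x (modified c) \<longrightarrow> s' y = s y"
    if "\<forall>y. y \<notin> modified ?c \<longrightarrow> s' y = ?s y" for s'
    using that by simp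
  show "wp N L (While (Less (Var x) e) ?c) Q ?s"
  proof (rule wp_While[where I = ?J and m = m])
    show "?J m ?s" using I0 Ix by (intro exI[of _ 0]) simp
    show "m \<le> N" by fact
  next
    fix k s' assume "?J k s'" "bval (Less (Var x) e) s'" and b: "bounded_store L s'"
      and "\<forall>y. y \<notin> modified ?c \<longrightarrow> s' y = ?s y"
    note fr = frame[OF this(4)]
    obtain i where i: "k = m - i" "s' x 0 = int i" "I i s'" using \<open>?J k s'\<close> by blast
    have "i < m" using \<open>bval _ s'\<close> e[OF fr] i by simp
    have "wp N L c (I (Suc i)) s'" by (rule step[OF \<open>i < m\<close> i(2,3) b fr])
    then show "wp N L ?c (\<lambda>s''. \<exists>k'<k. ?J k' s'') s'"
    proof (intro wp_Seq, elim wp_conseq, intro wp_Assign)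
      fix s1 assume "\<forall>y. y \<notin> modified c \<longrightarrow> s1 y = s' y" and I1: "I (Suc i) s1"
      then have s1: "s1 x 0 = int i" using x i(2) by simp
      show "\<bar>aval (Add (Var x) (Const 1)) s1\<bar> \<le> L" using s1 \<open>i < m\<close> m by simp
      show "\<exists>k'<k. ?J k' (upd s1 x (aval (Const 0) s1) (aval (Add (Var x) (Const 1)) s1))"
        using s1 I1 Ix \<open>i < m\<close> i(1) by (intro exI[of _ "m - Suc i"] conjI exI[of _ "Suc i"]) auto
    qed
  next
    fix k s' assume "?J k s'" "\<not> bval (Less (Var x) e) s'" and b: "bounded_store L s'"
      and "\<forall>y. y \<notin> modified ?c \<longrightarrow> s' y = ?s y"
    note fr = frame[OF this(4)]
    obtain i where i: "i \<le> m" "s' x 0 = int i" "I i s'" using \<open>?J k s'\<close> by blast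
    have "i = m" using \<open>\<not> bval _ s'\<close> e[OF fr] i by simp
    with i final b fr show "Q s'" by blast
  qed
qed

section \<open>The Hungarian method\<close>

locale assignment =
  fixes n :: nat and c :: "nat \<Rightarrow> nat \<Rightarrow> int" and Cm :: int
  assumes c_nonneg: "\<And>i j. i < n \<Longrightarrow> j < n \<Longrightarrow> 0 \<le> c i j"
    and c_le: "\<And>i j. i < n \<Longrightarrow> j < n \<Longrightarrow> c i j \<le> Cm"
begin

text \<open>The sign conditions bound \<open>u\<close> from below and \<open>v\<close> from above;
  together with \<open>potentials_bounded\<close> this keeps all potentials within
  \<open>Cm\<close>.\<close>

definition feasible :: "(nat \<Rightarrow> int) \<Rightarrow> (nat \<Rightarrow> int) \<Rightarrow> bool" where
  "feasible u v \<longleftrightarrow>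
     (\<forall>i<n. 0 \<le> u i) \<and> (\<forall>j<n. v j \<le> 0) \<and> (\<forall>i<n. \<forall>j<n. u i + v j \<le> c i j)"

text \<open>
  Rows \<open>0, \<dots>, k - 1\<close> have been matched and row \<open>k\<close> is being inserted. \<open>S\<close> and \<open>T\<close> are the rows
  and columns of the alternating tree rooted at \<open>k\<close>, and \<open>B\<close> is the set of occupied columns.
  Instead of parent pointers, every tree row \<open>i\<close> carries the whole matching \<open>M i\<close> that results
  from exchanging along the tree path to \<open>i\<close>: it covers all rows up to \<open>k\<close> except \<open>i\<close>. Hence no
  path ever has to be traced. The value of \<open>M i\<close> at \<open>i\<close> itself is meaningless.
\<close>

definition tree :: "nat \<Rightarrow> (nat \<Rightarrow> int) \<Rightarrow> (nat \<Rightarrow> int) \<Rightarrow> nat set \<Rightarrow> nat set \<Rightarrow>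
    (nat \<Rightarrow> nat \<Rightarrow> nat) \<Rightarrow> nat set \<Rightarrow> bool" where
  "tree k u v S T M B \<longleftrightarrow> k \<le> n \<and> k \<in> S \<and> S \<subseteq> {..k} \<and> T \<subseteq> B \<and> B \<subseteq> {..<n} \<and>
     (\<forall>j<n. j \<notin> B \<longrightarrow> v j = 0) \<and>
     (\<forall>i\<in>S. bij_betw (M i) ({..k} - {i}) B) \<and>
     (\<forall>i\<in>S. \<forall>q\<le>k. q \<noteq> i \<longrightarrow>
        q < n \<and> u q + v (M i q) = c q (M i q) \<and> (q \<in> S \<longleftrightarrow> M i q \<in> T)) \<and>
     (\<forall>i\<in>S. \<forall>i'\<in>S. \<forall>q\<le>k. q \<notin> S \<longrightarrow> M i q = M i' q)"

lemma treeD: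
  assumes "tree k u v S T M B"
  shows "k \<le> n" "k \<in> S" "S \<subseteq> {..k}" "T \<subseteq> B" "B \<subseteq> {..<n}"
    and "\<And>j. j < n \<Longrightarrow> j \<notin> B \<Longrightarrow> v j = 0"
    and "\<And>i. i \<in> S \<Longrightarrow> bij_betw (M i) ({..k} - {i}) B"
    and "\<And>i q. \<lbrakk>i \<in> S; q \<le> k; q \<noteq> i\<rbrakk> \<Longrightarrow> q < n"
    and "\<And>i q. \<lbrakk>i \<in> S; q \<le> k; q \<noteq> i\<rbrakk> \<Longrightarrow> u q + v (M i q) = c q (M i q)"
    and "\<And>i q. \<lbrakk>i \<in> S; q \<le> k; q \<noteq> i\<rbrakk> \<Longrightarrow> q \<in> S \<longleftrightarrow> M i q \<in> T"
    and "\<And>i i' q. \<lbrakk>i \<in> S; i' \<in> S; q \<le> k; q \<notin> S\<rbrakk> \<Longrightarrow> M i q = M i' q"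
  using assms unfolding tree_def by blast+

lemma tree_init: "tree 0 (\<lambda>_. 0) (\<lambda>_. 0) {0} {} M {}"
  by (simp add: tree_def bij_betw_def)

lemma feasible_init: "feasible (\<lambda>_. 0) (\<lambda>_. 0)"
  using c_nonneg by (simp add: feasible_def)

text \<open>\<open>B\<close> has exactly \<open>k\<close> elements, one for each row below
  \<open>k\<close>. The free column serves twice: as a column of potential 0, and as evidence that
  the search meets a candidate.\<close>

lemma tree_free_column:
  assumes "tree k u v S T M B" "k < n"
  obtains j where "j < n" "j \<notin> B"
proof -
  note t = treeD[OF assms(1)]
  have "card B = card ({..k} - {k})" using bij_betw_same_card[OF t(7)[OF t(2)]] by simp
  then have "card B < card {..<n}" using assms(2) by simp
  then have "B \<noteq> {..<n}" by auto
  with t(5) that show thesis by blast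
qed

text \<open>
  A free column has potential 0, so feasibility bounds the row potentials; tightness of the matched
  edges then bounds the column potentials. This keeps all numbers of polynomial length.
\<close>

lemma potentials_bounded:
  assumes "tree k u v S T M B" "feasible u v" "k < n"
  shows "\<And>i. i < n \<Longrightarrow> u i \<le> Cm" "\<And>j. j < n \<Longrightarrow> - Cm \<le> v j"
proof -
  note t = treeD[OF assms(1)]
  obtain j0 where j0: "j0 < n" "j0 \<notin> B" using tree_free_column assms(1,3) by blast
  show u: "u i \<le> Cm" if "i < n" for i
  proof -
    have "u i + v j0 \<le> c i j0" using assms(2) that j0 by (simp add: feasible_def)
    with t(6)[OF j0] c_le[OF that j0(1)] show ?thesis by simp
  qed
  show "- Cm \<le> v j" if "j < n" for j
  proof (cases "j \<in> B")
    case True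
    then obtain q where q: "q \<le> k" "q \<noteq> k" "j = M k q"
      using t(7)[OF t(2)] unfolding bij_betw_def by auto
    then show ?thesis
      using t(9)[OF t(2), of q] u[of q] t(8)[OF t(2), of q] c_nonneg[of q j] that by auto
  next
    case False
    with t(6) that c_nonneg[OF that that] c_le[OF that that] show ?thesis by simp
  qed
qed

text \<open>Used with \<open>d\<close> on tree rows and with \<open>- d\<close> on tree
  columns.\<close>

definition raise :: "int \<Rightarrow> nat set \<Rightarrow> (nat \<Rightarrow> int) \<Rightarrow> nat \<Rightarrow> int" where
  "raise d S u q = u q + d * of_bool (q \<in> S)"

text \<open>The shifts cancel on edges from \<open>S\<close> to \<open>T\<close>, edges from outside
  \<open>S\<close> into \<open>T\<close> only become looser, and edges leaving \<open>S\<close> for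
  a column outside \<open>T\<close> have slack at least \<open>d\<close>.\<close>

lemma feasible_raise:
  assumes "feasible u v" and "0 \<le> d"
    and "\<And>i j. \<lbrakk>i \<in> S; i < n; j < n; j \<notin> T\<rbrakk> \<Longrightarrow> d \<le> c i j - u i - v j"
  shows "feasible (raise d S u) (raise (- d) T v)"
proof -
  have "raise d S u i + raise (- d) T v j \<le> c i j" if "i < n" "j < n" for i j
    using assms(1,2) assms(3)[of i j] that unfolding feasible_def raise_def
    by (cases "i \<in> S"; cases "j \<in> T") force+
  moreover have "v j - d * of_bool (j \<in> T) \<le> 0" if "j < n" for j
    using assms(1,2) that unfolding feasible_def by (cases "j \<in> T") force+
  ultimately show ?thesis using assms(1,2) by (simp add: feasible_def raise_def)
qed

text \<open>Column \<open>j\<close> is occupied by row \<open>r\<close>. Raising by the slack makes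
  the edge from \<open>i\<close> to \<open>j\<close> tight; row \<open>i\<close>, the one not
  covered by \<open>M i\<close>, takes over \<open>j\<close>, and \<open>r\<close> becomes the
  uncovered row of the new matching.\<close>

lemma tree_grow:
  assumes "tree k u v S T M B" "i \<in> S" "i < n" "j < n" "j \<notin> T"
    and r: "r \<le> k" "r \<noteq> i" "M i r = j"
    and d: "d = c i j - u i - v j"
  shows "r \<notin> S"
    "tree k (raise d S u) (raise (- d) T v) (insert r S) (insert j T) (M(r := (M i)(i := j))) B"
proof -
  note t = treeD[OF assms(1)]
  show rS: "r \<notin> S" using t(10)[OF assms(2) r(1,2)] r(3) assms(5) by simp
  have bi: "bij_betw (M i) ({..k} - {i}) B" by (rule t(7)[OF assms(2)])
  have "j \<in> B" using bi r unfolding bij_betw_def by auto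
  have ik: "i \<le> k" using t(3) assms(2) by auto
  have iff: "M i' q = j \<longleftrightarrow> q = r" if "i' \<in> S" "q \<le> k" "q \<noteq> i'" for i' q
  proof -
    \<comment> \<open>All tree matchings agree outside \<open>S\<close>, so each of them sends
      \<open>r\<close> to \<open>j\<close>; by injectivity no other covered row goes there.\<close>
    have "M i' r = j" using t(11)[OF that(1) assms(2) r(1) rS] r(3) by simp
    moreover have "inj_on (M i') ({..k} - {i'})" using t(7)[OF that(1)] by (simp add: bij_betw_def)
    moreover have "r \<noteq> i'" using rS that(1) by auto
    ultimately show ?thesis using that r(1) unfolding inj_on_def by auto
  qed
  let ?M = "M(r := (M i)(i := j))"
  have bij: "bij_betw (?M i') ({..k} - {i'}) B" if "i' \<in> insert r S" for i'
  proof (cases "i' = r")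
    case True
    have "bij_betw (M i) ({..k} - {i} - {r}) (B - {j})"
      using bij_betw_DiffI[OF bi, of "{r}" "{j}"] r \<open>j \<in> B\<close> by (simp add: bij_betw_def)
    then have "bij_betw ((M i)(i := j)) ({..k} - {i} - {r}) (B - {j})"
      by (rule bij_betw_cong[THEN iffD1, rotated]) auto
    then have "bij_betw ((M i)(i := j)) (({..k} - {i} - {r}) \<union> {i}) ((B - {j}) \<union> {j})"
      by (intro bij_betw_combine) auto
    moreover have "({..k} - {i} - {r}) \<union> {i} = {..k} - {r}" "(B - {j}) \<union> {j} = B"
      using ik r \<open>j \<in> B\<close> by auto
    ultimately show ?thesis using True by simp
  next
    case False
    with that t(7)[of i'] show ?thesis by simp
  qed
  have tight: "q < n \<and> raise d S u q + raise (- d) T v (?M i' q) = c q (?M i' q) \<and>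
      (q \<in> insert r S \<longleftrightarrow> ?M i' q \<in> insert j T)"
    if "i' \<in> insert r S" "q \<le> k" "q \<noteq> i'" for i' q
  proof (cases "i' = r")
    case i': True
    show ?thesis
    proof (cases "q = i")
      case True
      \<comment> \<open>The new edge: \<open>i\<close> lies in \<open>S\<close> and \<open>j\<close>
        outside \<open>T\<close>, so the sum of the potentials grows by exactly the slack
        \<open>d\<close>.\<close>
      then show ?thesis using i' assms(2-5) d r by (simp add: raise_def)
    next
      case False
      with i' that t(8,9,10)[OF assms(2) that(2) False] iff[OF assms(2) that(2) False]
      show ?thesis by (simp add: raise_def)
    qed
  next
    case False
    then have i': "i' \<in> S" using that by simp
    \<comment> \<open>On a matched edge the row is in the tree exactly when the column is, so the
      shifts cancel or are both absent.\<close>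
    show ?thesis
      using False t(8,9,10)[OF i' that(2,3)] iff[OF i' that(2,3)] by (simp add: raise_def)
  qed
  have common: "?M i1 q = ?M i2 q"
    if "i1 \<in> insert r S" "i2 \<in> insert r S" "q \<le> k" "q \<notin> insert r S" for i1 i2 q
  proof -
    have "?M i' q = M i q" if "i' \<in> insert r S" for i'
      using t(11)[of i' i q] assms(2) that \<open>q \<le> k\<close> \<open>q \<notin> insert r S\<close> by (cases "i' = r") auto
    with that show ?thesis by metis
  qed
  show "tree k (raise d S u) (raise (- d) T v) (insert r S) (insert j T) ?M B"
    unfolding tree_def
  proof (intro conjI)
    show "\<forall>j<n. j \<notin> B \<longrightarrow> raise (- d) T v j = 0" using t(4,6) by (auto simp: raise_def)
    show "\<forall>i'\<in>insert r S. bij_betw (?M i') ({..k} - {i'}) B" using bij by blast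
    show "\<forall>i'\<in>insert r S. \<forall>q\<le>k. q \<noteq> i' \<longrightarrow> q < n \<and>
      raise d S u q + raise (- d) T v (?M i' q) = c q (?M i' q) \<and>
      (q \<in> insert r S \<longleftrightarrow> ?M i' q \<in> insert j T)" using tight by blast
    show "\<forall>i1\<in>insert r S. \<forall>i2\<in>insert r S. \<forall>q\<le>k. q \<notin> insert r S \<longrightarrow> ?M i1 q = ?M i2 q"
      using common by blast
  qed (use t(1-5) \<open>j \<in> B\<close> r(1) in auto)
qed

text \<open>With \<open>j\<close> free, the exchanged matching covers all rows up to
  \<open>k\<close>. The next root \<open>Suc k\<close> may equal \<open>n\<close>: this is a dummy
  row, whose matching is then the complete assignment.\<close>

lemma tree_augment:
  assumes "tree k u v S T M B" "i \<in> S" "i < n" "k < n" "j < n" "j \<notin> T"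
    and free: "\<And>q. q \<le> k \<Longrightarrow> q \<noteq> i \<Longrightarrow> M i q \<noteq> j"
    and d: "d = c i j - u i - v j"
  shows "tree (Suc k) (raise d S u) (raise (- d) T v) {Suc k} {} (M(Suc k := (M i)(i := j)))
    (insert j B)"
proof -
  note t = treeD[OF assms(1)]
  have bi: "bij_betw (M i) ({..k} - {i}) B" by (rule t(7)[OF assms(2)])
  have "j \<notin> B" using bi free unfolding bij_betw_def by force
  have ik: "i \<le> k" using t(3) assms(2) by auto
  have "bij_betw ((M i)(i := j)) ({..k} - {i}) B"
    using bi by (rule bij_betw_cong[THEN iffD1, rotated]) auto
  then have "bij_betw ((M i)(i := j)) (({..k} - {i}) \<union> {i}) (B \<union> {j})"
    using \<open>j \<notin> B\<close> by (intro bij_betw_combine) auto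
  moreover have "({..k} - {i}) \<union> {i} = {..Suc k} - {Suc k}" using ik by auto
  ultimately have bij: "bij_betw ((M i)(i := j)) ({..Suc k} - {Suc k}) (insert j B)" by simp
  have tight: "raise d S u q + raise (- d) T v (((M i)(i := j)) q) = c q (((M i)(i := j)) q)"
    if "q \<le> k" for q
  proof (cases "q = i")
    case True
    then show ?thesis using assms(2,6) d by (simp add: raise_def)
  next
    case False
    with t(9,10)[OF assms(2) that False] show ?thesis by (simp add: raise_def)
  qed
  show ?thesis
    unfolding tree_def using t(4-6) assms(4,5) bij tight by (auto simp: raise_def le_Suc_eq)
qed

text \<open>The sum of all potentials is a lower bound for every assignment, and the tight edges of
  \<open>M n\<close> attain it.\<close>

lemma tree_optimal:
  assumes "tree n u v S T M B" "feasible u v"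
  shows "bij_betw (M n) {..<n} {..<n}"
    and "bij_betw \<sigma> {..<n} {..<n} \<Longrightarrow> (\<Sum>i<n. c i (M n i)) \<le> (\<Sum>i<n. c i (\<sigma> i))"
proof -
  note t = treeD[OF assms(1)]
  have dom: "{..n} - {n} = {..<n}" by auto
  have bijB: "bij_betw (M n) {..<n} B" using t(7)[OF t(2)] by (simp add: dom)
  have "B = {..<n}"
    using bij_betw_same_card[OF bijB] t(5) by (intro card_subset_eq) auto
  with bijB show bij: "bij_betw (M n) {..<n} {..<n}" by simp
  assume \<sigma>: "bij_betw \<sigma> {..<n} {..<n}"
  have "(\<Sum>i<n. c i (M n i)) = (\<Sum>i<n. u i + v (M n i))"
    using t(9)[OF t(2)] by (intro sum.cong) auto
  also have "\<dots> = (\<Sum>i<n. u i) + (\<Sum>j<n. v j)"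
    using sum.reindex_bij_betw[OF bij, of v] by (simp add: sum.distrib)
  also have "\<dots> = (\<Sum>i<n. u i + v (\<sigma> i))"
    using sum.reindex_bij_betw[OF \<sigma>, of v] by (simp add: sum.distrib)
  also have "\<dots> \<le> (\<Sum>i<n. c i (\<sigma> i))"
    using assms(2) bij_betwE[OF \<sigma>] by (intro sum_mono) (simp add: feasible_def)
  finally show "(\<Sum>i<n. c i (M n i)) \<le> (\<Sum>i<n. c i (\<sigma> i))" .
qed

text \<open>The pair of \<open>k\<close> and \<open>card S\<close> in lexicographic order, written
  in base \<open>n + 1\<close>; while \<open>k < n\<close>, \<open>card S\<close> is at most
  \<open>n\<close>. The value \<open>(n + 1)\<^sup>2\<close> lies above all these codes, so
  truncated subtraction does no harm.\<close>

definition variant :: "nat \<Rightarrow> nat set \<Rightarrow> nat" where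
  "variant k S = (n + 1)\<^sup>2 - (k * (n + 1) + card S)"

lemma card_rows_le:
  assumes "S \<subseteq> {..k}"
  shows "card S \<le> Suc k"
  using card_mono[OF _ assms] by simp

lemma variant_bound: "k < n \<Longrightarrow> S \<subseteq> {..k} \<Longrightarrow> k * (n + 1) + card S < (n + 1)\<^sup>2"
proof -
  assume "k < n" "S \<subseteq> {..k}"
  then have "k * (n + 1) + card S < (k + 1) * (n + 1)" using card_rows_le[of S k] by simp
  also have "\<dots> \<le> (n + 1) * (n + 1)" using \<open>k < n\<close> by (intro mult_right_mono) auto
  finally show ?thesis by (simp add: power2_eq_square)
qed

lemma variant_grow:
  assumes "k < n" "S \<subseteq> {..k}" "r \<le> k" "r \<notin> S"
  shows "variant k (insert r S) < variant k S"
proof -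
  have "finite S" using assms(2) finite_subset by blast
  then show ?thesis
    using variant_bound[OF assms(1,2)] assms(4) by (simp add: variant_def)
qed

lemma variant_augment:
  assumes "k < n" "S \<subseteq> {..k}"
  shows "variant (Suc k) {Suc k} < variant k S"
  using variant_bound[OF assms] card_rows_le[OF assms(2)] assms(1) by (simp add: variant_def)

end

section \<open>The Hungarian method on the machine\<close>

abbreviation (input) "arr_Q \<equiv> 2 :: nat"
abbreviation (input) "var_e \<equiv> 3 :: nat"
abbreviation (input) "var_x \<equiv> 4 :: nat"
abbreviation (input) "var_acc \<equiv> 5 :: nat"
abbreviation (input) "arr_C \<equiv> 6 :: nat"
abbreviation (input) "var_t \<equiv> 7 :: nat"
abbreviation (input) "var_j \<equiv> 8 :: nat"
abbreviation (input) "var_i \<equiv> 9 :: nat"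
abbreviation (input) "arr_u \<equiv> 10 :: nat"
abbreviation (input) "arr_v \<equiv> 11 :: nat"
abbreviation (input) "arr_S \<equiv> 12 :: nat"
abbreviation (input) "arr_T \<equiv> 13 :: nat"
abbreviation (input) "arr_M \<equiv> 14 :: nat"
abbreviation (input) "var_k \<equiv> 15 :: nat"
abbreviation (input) "var_found \<equiv> 16 :: nat"
abbreviation (input) "var_d \<equiv> 17 :: nat"
abbreviation (input) "var_bi \<equiv> 18 :: nat"
abbreviation (input) "var_bj \<equiv> 19 :: nat"
abbreviation (input) "var_r \<equiv> 20 :: nat"

abbreviation (input) Set :: "nat \<Rightarrow> aexp \<Rightarrow> com" where
  "Set x e \<equiv> Assign x (Const 0) e"

abbreviation (input) Equal :: "aexp \<Rightarrow> aexp \<Rightarrow> bexp" where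
  "Equal a b \<equiv> Conj (Neg (Less a b)) (Neg (Less b a))"

abbreviation (input) "exp_n \<equiv> Cell 0 (Const 1)"
abbreviation (input) "exp_K \<equiv> Cell 0 (Const 2)"

abbreviation (input) Cell2 :: "nat \<Rightarrow> aexp \<Rightarrow> aexp \<Rightarrow> aexp" where
  "Cell2 x a b \<equiv> Cell x (Add (Mul a exp_n) b)"

text \<open>Injectivity of the row-major layout: writing one matrix entry leaves the others
  alone.\<close>

lemma index2_eq_iff [simp]:
  assumes "q < n" "q' < n"
  shows "int i * int n + int q = int i' * int n + int q' \<longleftrightarrow> i = i' \<and> q = q'"
proof
  assume "int i * int n + int q = int i' * int n + int q'"
  then have eq: "i * n + q = i' * n + q'" by (metis of_nat_add of_nat_eq_iff of_nat_mult)
  have "(i * n + q) div n = i" "(i' * n + q') div n = i'" using assms by auto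
  with eq show "i = i' \<and> q = q'" by auto
qed simp

definition slack_exp :: aexp where
  "slack_exp = Sub (Sub (Cell2 arr_C (Var var_t) (Var var_j)) (Cell arr_u (Var var_t)))
     (Cell arr_v (Var var_j))"

text \<open>\<open>var_found = 0\<close> plays the role of an infinite initial minimum.\<close>

definition search_step_com :: com where
  "search_step_com = Cond
     (Conj (Conj (Less (Const 0) (Cell arr_S (Var var_t))) (Less (Cell arr_T (Var var_j)) (Const 1)))
       (Neg (Conj (Less (Const 0) (Var var_found)) (Neg (Less slack_exp (Var var_d))))))
     (Seq (Set var_found (Const 1)) (Seq (Set var_d slack_exp)
       (Seq (Set var_bi (Var var_t)) (Set var_bj (Var var_j)))))
     Skip"

definition search_com :: com where
  "search_com = Seq (Set var_found (Const 0))
     (For var_t exp_n (For var_j exp_n search_step_com))"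

definition shift_com :: com where
  "shift_com = For var_t exp_n
     (Seq (Assign arr_u (Var var_t)
            (Add (Cell arr_u (Var var_t)) (Mul (Var var_d) (Cell arr_S (Var var_t)))))
          (Assign arr_v (Var var_t)
            (Sub (Cell arr_v (Var var_t)) (Mul (Var var_d) (Cell arr_T (Var var_t))))))"

text \<open>The comparison of \<open>var_t\<close> with \<open>var_bi\<close> excludes the
  meaningless entry of \<open>M i\<close> at \<open>i\<close>, which might happen to equal
  \<open>j\<close>.\<close>

definition find_com :: com where
  "find_com = Seq (Set var_r (Add (Var var_k) (Const 1)))
     (For var_t (Add (Var var_k) (Const 1))
       (Cond (Conj (Equal (Cell2 arr_M (Var var_bi) (Var var_t)) (Var var_bj))
                (Neg (Equal (Var var_t) (Var var_bi))))
         (Set var_r (Var var_t)) Skip))"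

definition copy_com :: com where
  "copy_com = Seq
     (For var_t exp_n (Assign arr_M (Add (Mul (Var var_r) exp_n) (Var var_t))
        (Cell2 arr_M (Var var_bi) (Var var_t))))
     (Assign arr_M (Add (Mul (Var var_r) exp_n) (Var var_bi)) (Var var_bj))"

text \<open>
  \<open>find_com\<close> leaves \<open>k + 1\<close> in \<open>var_r\<close> if the new column is free. Then the augmented matching has
  been copied to row \<open>k + 1\<close>, which becomes the root of the next tree.
\<close>

definition label_com :: com where
  "label_com = Seq
     (Cond (Less (Var var_k) (Var var_r))
       (Seq (Set var_k (Var var_r))
         (For var_t exp_n (Seq (Assign arr_S (Var var_t) (Const 0)) (Assign arr_T (Var var_t) (Const 0)))))
       (Assign arr_T (Var var_bj) (Const 1)))
     (Assign arr_S (Var var_r) (Const 1))"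

definition step_com :: com where
  "step_com = Seq search_com (Seq shift_com (Seq find_com (Seq copy_com label_com)))"

definition hungarian_com :: com where
  "hungarian_com = Seq (Assign arr_S (Const 0) (Const 1))
     (While (Less (Var var_k) exp_n) step_com)"

lemma modified_step_coms:
  "modified search_com = {var_t, var_j, var_found, var_d, var_bi, var_bj}"
  "modified shift_com = {var_t, arr_u, arr_v}"
  "modified find_com = {var_t, var_r}"
  "modified copy_com = {var_t, arr_M}"
  "modified label_com = {var_t, var_k, arr_S, arr_T}"
  by (auto simp: search_com_def search_step_com_def shift_com_def find_com_def copy_com_def
      label_com_def)

text \<open>\<open>N\<close> covers the initial value of \<open>variant\<close>. With potentials
  within \<open>Cm\<close>, a slack is at most \<open>2 * Cm\<close> and a shifted potential at most
  \<open>3 * Cm\<close> in absolute value; \<open>int n + 1\<close> leaves room for counters,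
  indices and flags.\<close>

locale assignment_ram = assignment +
  fixes N :: nat and L :: int
  assumes N_ge: "(n + 1)\<^sup>2 \<le> N" and L_ge: "int n + 1 \<le> L" "4 * Cm \<le> L"
begin

lemma n_le_N: "n + 1 \<le> N"
  using N_ge by (simp add: power2_eq_square)

definition cost_stored :: "store \<Rightarrow> bool" where
  "cost_stored s \<longleftrightarrow> s 0 1 = int n \<and>
     (\<forall>i<n. \<forall>j<n. s arr_C (int i * int n + int j) = c i j)"

text \<open>The arrays for \<open>S\<close> and \<open>M\<close> include row \<open>n\<close>: the
  last augmentation makes this dummy row the root and stores the final matching there.\<close>

definition represents :: "store \<Rightarrow> nat \<Rightarrow> (nat \<Rightarrow> int) \<Rightarrow> (nat \<Rightarrow> int) \<Rightarrow> nat set \<Rightarrow> nat set \<Rightarrow>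
    (nat \<Rightarrow> nat \<Rightarrow> nat) \<Rightarrow> bool" where
  "represents s k u v S T M \<longleftrightarrow> s var_k 0 = int k \<and>
     (\<forall>i<n. s arr_u (int i) = u i) \<and> (\<forall>j<n. s arr_v (int j) = v j) \<and>
     (\<forall>i\<le>n. s arr_S (int i) = of_bool (i \<in> S)) \<and> (\<forall>j<n. s arr_T (int j) = of_bool (j \<in> T)) \<and>
     (\<forall>i\<le>n. \<forall>q<n. s arr_M (int i * int n + int q) = int (M i q))"

lemma search_correct:
  assumes cs: "cost_stored s" and rep: "represents s k u v S T M" and tr: "tree k u v S T M B"
    and fe: "feasible u v" and k: "k < n"
  shows "wp N L search_com (\<lambda>s'. \<exists>i j. s' var_bi 0 = int i \<and> s' var_bj 0 = int j \<and>
     i \<in> S \<and> i < n \<and> j < n \<and> j \<notin> T \<and> s' var_d 0 = c i j - u i - v j \<and>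
     (\<forall>i'\<in>S. \<forall>j'<n. i' < n \<longrightarrow> j' \<notin> T \<longrightarrow> c i j - u i - v j \<le> c i' j' - u i' - v j')) s"
proof -
  note pb = potentials_bounded[OF tr fe k]
  \<comment> \<open>\<open>P\<close> describes the pairs scanned so far; both nested loops use this
    invariant with prefixes of the lexicographic order.\<close>
  define J where "J P s' \<longleftrightarrow>
     (\<forall>i j. i < n \<and> j < n \<and> i \<in> S \<and> j \<notin> T \<and> P i j \<longrightarrow>
        s' var_found 0 = 1 \<and> s' var_d 0 \<le> c i j - u i - v j) \<and>
     (s' var_found 0 = 0 \<or> s' var_found 0 = 1 \<and> (\<exists>i j. s' var_bi 0 = int i \<and> s' var_bj 0 = int j \<and>
       i \<in> S \<and> i < n \<and> j < n \<and> j \<notin> T \<and> s' var_d 0 = c i j - u i - v j))"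
    for P and s' :: store
  have slack_le: "\<bar>c i j - u i - v j\<bar> \<le> L" if "i < n" "j < n" for i j
    using pb(1)[OF that(1)] pb(2)[OF that(2)] c_le[OF that] c_nonneg[OF that] fe that L_ge
    unfolding feasible_def by (smt (verit))
  have step: "wp N L search_step_com (J (\<lambda>i' j'. i' < i \<or> i' = i \<and> j' < Suc j)) s'"
    if "i < n" "j < n" "s' var_t 0 = int i" "s' var_j 0 = int j"
      "J (\<lambda>i' j'. i' < i \<or> i' = i \<and> j' < j) s'" "s' 0 = s 0" "s' arr_C = s arr_C" "s' arr_u = s arr_u"
      "s' arr_v = s arr_v" "s' arr_S = s arr_S" "s' arr_T = s arr_T" for i j s'
  proof -
    have sl: "aval slack_exp s'' = c i j - u i - v j"
      if "s'' 0 = s 0" "s'' arr_C = s arr_C" "s'' arr_u = s arr_u" "s'' arr_v = s arr_v"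
        "s'' var_t = s' var_t" "s'' var_j = s' var_j" for s''
      using cs rep that \<open>s' var_t 0 = int i\<close> \<open>s' var_j 0 = int j\<close> \<open>i < n\<close> \<open>j < n\<close>
      by (simp add: slack_exp_def cost_stored_def represents_def)
    have ST: "s arr_S (int i) = of_bool (i \<in> S)" "s arr_T (int j) = of_bool (j \<in> T)"
      using rep that(1,2) by (simp_all add: represents_def)
    have L1: "1 \<le> L" "int i \<le> L" "int j \<le> L" using L_ge that(1,2) by simp_all
    show ?thesis
      unfolding search_step_com_def
    proof (rule wp_Cond, goal_cases)
      case 1
      then have b: "i \<in> S" "j \<notin> T" "\<not> 0 < s' var_found 0 \<or> c i j - u i - v j < s' var_d 0"
        using that ST sl[of s'] by auto
      have old: "c i j - u i - v j \<le> c i' j' - u i' - v j'"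
        if "i' < n" "j' < n" "i' \<in> S" "j' \<notin> T" "i' < i \<or> i' = i \<and> j' < Suc j" for i' j'
      proof (cases "i' = i \<and> j' = j")
        case False
        then have "s' var_found 0 = 1 \<and> s' var_d 0 \<le> c i' j' - u i' - v j'"
          using \<open>J _ s'\<close> that unfolding J_def by (metis less_Suc_eq)
        with b(3) show ?thesis by auto
      qed simp
      have new: "J (\<lambda>i' j'. i' < i \<or> i' = i \<and> j' < Suc j) s''"
        if "s'' var_found 0 = 1" "s'' var_d 0 = c i j - u i - v j"
          "s'' var_bi 0 = int i" "s'' var_bj 0 = int j" for s''
        unfolding J_def
      proof (intro conjI allI impI disjI2)
        show "s'' var_d 0 \<le> c i' j' - u i' - v j'"
          if "i' < n \<and> j' < n \<and> i' \<in> S \<and> j' \<notin> T \<and> (i' < i \<or> i' = i \<and> j' < Suc j)" for i' j'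
          using old[of i' j'] that \<open>s'' var_d 0 = _\<close> by simp
      qed (use that b(1,2) \<open>i < n\<close> \<open>j < n\<close> in simp_all)
      show ?case
        using that(1-4,6-) sl slack_le[OF that(1,2)] L1 by (intro wp_Seq wp_Assign new) simp_all
    next
      case 2
      then have b: "i \<in> S \<Longrightarrow> j \<notin> T \<Longrightarrow> 0 < s' var_found 0 \<and> s' var_d 0 \<le> c i j - u i - v j"
        using that ST sl[of s'] by auto
      show ?case
        using that(5) b by (intro wp_Skip) (auto simp: J_def less_Suc_eq)
    qed
  qed
  have sn: "s 0 1 = int n" using cs by (simp add: cost_stored_def)
  \<comment> \<open>Row \<open>k\<close> and a free column form a candidate pair, so the scan cannot
    end with \<open>var_found = 0\<close>.\<close>
  obtain j0 where "j0 < n" "j0 \<notin> B" using tree_free_column[OF tr k] .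
  then have j0: "j0 < n" "j0 \<notin> T" using treeD(4)[OF tr] by auto
  have kS: "k \<in> S" by (rule treeD(2)[OF tr])
  have m: "modified search_step_com = {var_found, var_d, var_bi, var_bj}"
    by (auto simp: search_step_com_def)
  have row: "wp N L (For var_j exp_n search_step_com) (J (\<lambda>i' j'. i' < Suc i)) s'"
    if "i < n" "s' var_t 0 = int i" "J (\<lambda>i' j'. i' < i) s'" "s' 0 = s 0" "s' arr_C = s arr_C"
      "s' arr_u = s arr_u" "s' arr_v = s arr_v" "s' arr_S = s arr_S" "s' arr_T = s arr_T" for i s'
  proof (rule wp_For[where m = n and I = "\<lambda>j. J (\<lambda>i' j'. i' < i \<or> i' = i \<and> j' < j)"], goal_cases)
    case (7 j s'')
    then show ?case using that by (intro step) (simp_all add: m)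
  next
    case (8 s'')
    then show ?case by (auto simp: J_def less_Suc_eq)
  qed (use that n_le_N L_ge sn m in \<open>simp_all add: J_def\<close>)
  have "wp N L (For var_t exp_n (For var_j exp_n search_step_com)) (\<lambda>s'. J (\<lambda>i' j'. i' < n) s')
    (upd s var_found 0 0)"
  proof (rule wp_For[where m = n and I = "\<lambda>i. J (\<lambda>i' j'. i' < i)"], goal_cases)
    case (7 i s'')
    then show ?case by (intro row) (simp_all add: m)
  qed (use n_le_N L_ge sn m in \<open>simp_all add: J_def\<close>)
  then have "wp N L (For var_t exp_n (For var_j exp_n search_step_com)) (\<lambda>s'. \<exists>i j.
     s' var_bi 0 = int i \<and> s' var_bj 0 = int j \<and>
     i \<in> S \<and> i < n \<and> j < n \<and> j \<notin> T \<and> s' var_d 0 = c i j - u i - v j \<and>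
     (\<forall>i'\<in>S. \<forall>j'<n. i' < n \<longrightarrow> j' \<notin> T \<longrightarrow> c i j - u i - v j \<le> c i' j' - u i' - v j'))
     (upd s var_found 0 0)"
  proof (rule wp_conseq, goal_cases)
    case (1 s')
    then have all: "s' var_found 0 = 1 \<and> s' var_d 0 \<le> c i j - u i - v j"
      if "i < n" "j < n" "i \<in> S" "j \<notin> T" for i j
      using that unfolding J_def by blast
    have "s' var_found 0 = 1" using all[OF k j0(1) kS j0(2)] by simp
    with 1(3) obtain i j where "s' var_bi 0 = int i" "s' var_bj 0 = int j"
       "i \<in> S" "i < n" "j < n" "j \<notin> T" "s' var_d 0 = c i j - u i - v j"
      unfolding J_def by auto
    with all show ?case by metis
  qed
  then show ?thesis
    unfolding search_com_def using L_ge by (intro wp_Seq wp_Assign) simp_all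
qed

lemma shift_correct:
  assumes "s 0 1 = int n" "represents s k u v S T M"
    and d: "s var_d 0 = d" "\<bar>d\<bar> \<le> 2 * Cm"
    and "\<And>i. i < n \<Longrightarrow> \<bar>u i\<bar> \<le> Cm" "\<And>j. j < n \<Longrightarrow> \<bar>v j\<bar> \<le> Cm"
  shows "wp N L shift_com (\<lambda>s'. represents s' k (raise d S u) (raise (- d) T v) S T M) s"
  unfolding shift_com_def
proof (rule wp_For[where m = n and I = "\<lambda>i s'.
    represents s' k (\<lambda>q. if q < i then raise d S u q else u q)
      (\<lambda>q. if q < i then raise (- d) T v q else v q) S T M"], goal_cases)
  case (7 i s')
  then have *: "s' arr_u (int i) = u i" "s' arr_v (int i) = v i" "s' var_d 0 = d"
    "s' arr_S (int i) = of_bool (i \<in> S)" "s' arr_T (int i) = of_bool (i \<in> T)"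
    using d by (simp_all add: represents_def)
  have "\<bar>u i + d * of_bool (i \<in> S)\<bar> \<le> L" "\<bar>v i - d * of_bool (i \<in> T)\<bar> \<le> L"
    using assms(5)[OF 7(1)] assms(6)[OF 7(1)] d L_ge by (auto simp: of_bool_def)
  with * 7 show ?case
    by (intro wp_Seq wp_Assign) (auto simp: represents_def raise_def less_Suc_eq)
next
  case (8 s')
  then show ?case by (simp add: represents_def)
qed (use assms n_le_N L_ge in \<open>simp_all add: represents_def\<close>)

lemma find_correct:
  assumes "s 0 1 = int n" "represents s k u v S T M" "k < n"
    and ij: "s var_bi 0 = int i" "s var_bj 0 = int j" "i < n"
  shows "wp N L find_com (\<lambda>s'. \<exists>r. s' var_r 0 = int r \<and>
    (r \<le> k \<and> r \<noteq> i \<and> M i r = j \<or> r = Suc k \<and> (\<forall>q\<le>k. q \<noteq> i \<longrightarrow> M i q \<noteq> j))) s"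
proof -
  define J where "J p s' \<longleftrightarrow> (\<exists>r. s' var_r 0 = int r \<and>
    (r \<le> k \<and> r \<noteq> i \<and> M i r = j \<or> r = Suc k \<and> (\<forall>q<p. q \<noteq> i \<longrightarrow> M i q \<noteq> j)))"
    for p and s' :: store
  have sk: "s var_k 0 = int k" using assms(2) by (simp add: represents_def)
  have "wp N L (For var_t (Add (Var var_k) (Const 1))
       (Cond (Conj (Equal (Cell2 arr_M (Var var_bi) (Var var_t)) (Var var_bj))
                (Neg (Equal (Var var_t) (Var var_bi))))
         (Set var_r (Var var_t)) Skip)) (J (Suc k)) (upd s var_r 0 (int k + 1))"
  proof (rule wp_For[where m = "Suc k" and I = J], goal_cases)
    case (7 q s')
    have qn: "q < n" "q \<le> k" using 7(1) assms(3) by simp_all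
    have M: "s arr_M (int i * int n + int q) = int (M i q)"
      using assms(2) ij(3) qn by (simp add: represents_def)
    show ?case
    proof (rule wp_Cond, goal_cases)
      case 1
      then have "M i q = j" "q \<noteq> i" using 7 assms(1) ij M by auto
      then show ?case using 7 qn L_ge by (intro wp_Assign) (auto simp: J_def)
    next
      case 2
      then have "\<not> (M i q = j \<and> q \<noteq> i)" using 7 assms(1) ij M by auto
      then show ?case using 7(3) by (intro wp_Skip) (auto simp: J_def less_Suc_eq)
    qed
  next
    case 5
    show ?case unfolding J_def by (intro exI[of _ "Suc k"]) simp
  qed (use assms sk n_le_N L_ge in \<open>simp_all add: J_def\<close>)
  then have "wp N L (For var_t (Add (Var var_k) (Const 1))
       (Cond (Conj (Equal (Cell2 arr_M (Var var_bi) (Var var_t)) (Var var_bj))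
                (Neg (Equal (Var var_t) (Var var_bi))))
         (Set var_r (Var var_t)) Skip)) (\<lambda>s'. \<exists>r. s' var_r 0 = int r \<and>
    (r \<le> k \<and> r \<noteq> i \<and> M i r = j \<or> r = Suc k \<and> (\<forall>q\<le>k. q \<noteq> i \<longrightarrow> M i q \<noteq> j)))
     (upd s var_r 0 (int k + 1))"
    by (rule wp_conseq) (simp add: J_def less_Suc_eq_le)
  then show ?thesis
    unfolding find_com_def using sk assms(3) L_ge by (intro wp_Seq wp_Assign) simp_all
qed

lemma copy_correct:
  assumes "s 0 1 = int n" "represents s k u v S T M"
    and ij: "s var_bi 0 = int i" "s var_bj 0 = int j" "i < n" "j < n"
    and r: "s var_r 0 = int r" "r \<le> n" "r \<noteq> i"
  shows "wp N L copy_com (\<lambda>s'. represents s' k u v S T (M(r := (M i)(i := j)))) s"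
proof -
  have "wp N L (For var_t exp_n (Assign arr_M (Add (Mul (Var var_r) exp_n) (Var var_t))
        (Cell2 arr_M (Var var_bi) (Var var_t))))
      (\<lambda>s'. represents s' k u v S T (M(r := M i))) s"
  proof (rule wp_For[where m = n and
      I = "\<lambda>p s'. represents s' k u v S T (M(r := \<lambda>q. if q < p then M i q else M r q))"], goal_cases)
    case (7 p s')
    have "s' arr_M (int i * int n + int p) = int (M i p)"
      using 7(1,3) ij(3) r(3) by (simp add: represents_def)
    \<comment> \<open>The copied entry may be the meaningless one at \<open>i\<close>; its bound
      therefore comes from the store and not from the matching.\<close>
    moreover have "\<bar>s' arr_M (int i * int n + int p)\<bar> \<le> L"
      using 7(4) by (simp add: bounded_store_def)
    ultimately show ?case using 7 assms(1) ij r
      by (intro wp_Assign) (auto simp: represents_def less_Suc_eq)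
  next
    case (8 s')
    then show ?case by (simp add: represents_def)
  qed (use assms n_le_N L_ge in \<open>simp_all add: represents_def\<close>)
  then show ?thesis
    unfolding copy_com_def
  proof (intro wp_Seq, elim wp_conseq, goal_cases)
    case (1 s')
    then show ?case using assms(1) ij r L_ge
      by (intro wp_Assign) (auto simp: represents_def)
  qed
qed

lemma label_correct:
  assumes "s 0 1 = int n" "represents s k u v S T M" "k < n" "S \<subseteq> {..k}"
    and "s var_bj 0 = int j" "j < n" "s var_r 0 = int r"
  shows "r \<le> k \<Longrightarrow> wp N L label_com (\<lambda>s'. represents s' k u v (insert r S) (insert j T) M) s"
    and "r = Suc k \<Longrightarrow> wp N L label_com (\<lambda>s'. represents s' (Suc k) u v {Suc k} {} M) s"
proof -
  have sk: "s var_k 0 = int k" using assms(2) by (simp add: represents_def)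
  {
    assume "r \<le> k"
    then show "wp N L label_com (\<lambda>s'. represents s' k u v (insert r S) (insert j T) M) s"
      unfolding label_com_def using assms sk L_ge
      by (intro wp_Seq wp_Cond wp_Assign) (auto simp: represents_def)
  next
    assume r: "r = Suc k"
    have "wp N L (For var_t exp_n
        (Seq (Assign arr_S (Var var_t) (Const 0)) (Assign arr_T (Var var_t) (Const 0))))
      (\<lambda>s'. represents s' (Suc k) u v {} {} M) (upd s var_k 0 (int (Suc k)))"
    proof (rule wp_For[where m = n and
        I = "\<lambda>p s'. represents s' (Suc k) u v (S - {..<p}) (T - {..<p}) M"], goal_cases)
      case (7 p s')
      then show ?case using L_ge
        by (intro wp_Seq wp_Assign) (auto simp: represents_def)
    next
      case (8 s')
      \<comment> \<open>The loop clears only indices below \<open>n\<close>. This empties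
        \<open>S\<close>, because its rows are at most \<open>k\<close> and
        \<open>k < n\<close>.\<close>
      have "S - {..<n} = {}" using assms(3,4) by auto
      with 8 show ?case by (auto simp: represents_def)
    qed (use assms n_le_N L_ge in \<open>simp_all add: represents_def\<close>)
    then show "wp N L label_com (\<lambda>s'. represents s' (Suc k) u v {Suc k} {} M) s"
      unfolding label_com_def
    proof (intro wp_Seq wp_Cond wp_Assign, goal_cases)
      case 2
      then show ?case
        using assms(3,7) r L_ge
        by (auto elim!: wp_conseq intro!: wp_Assign simp: represents_def)
    qed (use assms sk L_ge r in simp_all)
  }
qed

lemma step_correct:
  assumes cs: "cost_stored s" and rep: "represents s k u v S T M" and tr: "tree k u v S T M B"
    and fe: "feasible u v" and k: "k < n"
  shows "wp N L step_com (\<lambda>s'. \<exists>k' u' v' S' T' M' B'. represents s' k' u' v' S' T' M' \<and>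
    tree k' u' v' S' T' M' B' \<and> feasible u' v' \<and> variant k' S' < variant k S) s"
  unfolding step_com_def
proof (rule wp_Seq, rule wp_conseq[OF search_correct[OF assms]], elim exE conjE, goal_cases)
  case (1 s1 i j)
  note s1 = 1
  define d where "d = c i j - u i - v j"
  let ?u = "raise d S u" and ?v = "raise (- d) T v"
  note pb = potentials_bounded[OF tr fe k]
  have n1: "s1 0 1 = int n" using cs s1(2) by (simp add: cost_stored_def modified_step_coms)
  have rep1: "represents s1 k u v S T M"
    using rep s1(2) by (simp add: represents_def modified_step_coms)
  have d0: "0 \<le> d" "\<bar>d\<bar> \<le> 2 * Cm"
    using fe s1 pb(1)[of i] pb(2)[of j] c_le[of i j] unfolding feasible_def d_def by force+
  have ub: "\<bar>u q\<bar> \<le> Cm" "\<bar>v q\<bar> \<le> Cm" if "q < n" for q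
    using fe pb[OF that] that by (force simp: feasible_def)+
  have fe': "feasible ?u ?v" using fe d0(1) s1(10) by (intro feasible_raise) (auto simp: d_def)
  have iS: "i \<in> S" "i < n" "j < n" "j \<notin> T" by fact+
  have "s1 var_d 0 = d" using s1 by (simp add: d_def)
  show ?case
  proof (rule wp_Seq, rule wp_conseq[OF shift_correct[OF n1 rep1 \<open>s1 var_d 0 = d\<close> d0(2) ub]],
      goal_cases)
    case (3 s2)
    have n2: "s2 0 1 = int n" "s2 var_bi 0 = int i" "s2 var_bj 0 = int j"
      using n1 s1 3(2) by (simp_all add: modified_step_coms)
    show ?case
    proof (rule wp_Seq, rule wp_conseq[OF find_correct[OF n2(1) 3(3) k n2(2,3) iS(2)]],
        elim exE conjE, goal_cases)
      case (1 s3 r)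
      have n3: "s3 0 1 = int n" "s3 var_bi 0 = int i" "s3 var_bj 0 = int j"
        using n2 1(2) by (simp_all add: modified_step_coms)
      have rep3: "represents s3 k ?u ?v S T M"
        using 3(3) 1(2) by (simp add: represents_def modified_step_coms)
      have "i \<le> k" using treeD(3)[OF tr] iS(1) by auto
      then have r: "r \<le> n" "r \<noteq> i" using 1(4) k by auto
      show ?case
      proof (rule wp_Seq, rule wp_conseq[OF copy_correct[OF n3(1) rep3 n3(2,3) iS(2,3) 1(3) r]],
          goal_cases)
        case s4: (1 s4)
        let ?M = "M(r := (M i)(i := j))"
        have n4: "s4 0 1 = int n" "s4 var_bj 0 = int j" "s4 var_r 0 = int r"
          using n3 s4(2) 1(3) by (simp_all add: modified_step_coms)
        note label = label_correct[OF n4(1) s4(3) k treeD(3)[OF tr] n4(2) iS(3) n4(3)]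
        \<comment> \<open>A row found means that column \<open>j\<close> is occupied and the tree
          grows; the default \<open>Suc k\<close> means that \<open>j\<close> is free and the
          matching is augmented.\<close>
        consider "r \<le> k" "M i r = j" | "r = Suc k" "\<And>q. q \<le> k \<Longrightarrow> q \<noteq> i \<Longrightarrow> M i q \<noteq> j"
          using 1(4) by blast
        then show ?case
        proof cases
          case 1
          note g = tree_grow[OF tr iS 1(1) r(2) 1(2) d_def]
          show ?thesis
            using g(2) fe' variant_grow[OF k treeD(3)[OF tr] 1(1) g(1)]
            by (intro wp_conseq[OF label(1)[OF 1(1)]]) blast
        next
          case 2
          note g = tree_augment[OF tr iS(1,2) k iS(3,4) 2(2) d_def]
          show ?thesis
            using g fe' variant_augment[OF k treeD(3)[OF tr]] 2(1)
            by (intro wp_conseq[OF label(2)[OF 2(1)]]) blast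
        qed
      qed
    qed
  qed
qed

text \<open>Memory that is still 0 already encodes the zero potentials, the empty \<open>T\<close>,
  \<open>k = 0\<close> and an arbitrary matching; only the root flag of row 0 has to be
  written.\<close>

lemma hungarian_correct:
  assumes cs: "cost_stored s"
    and zero: "\<And>x i. x \<in> {arr_u, arr_v, arr_S, arr_T, arr_M, var_k} \<Longrightarrow> s x i = 0"
  shows "wp N L hungarian_com (\<lambda>s'. \<exists>\<mu>. bij_betw \<mu> {..<n} {..<n} \<and>
    (\<forall>q<n. s' arr_M (int n * int n + int q) = int (\<mu> q)) \<and>
    (\<forall>\<sigma>. bij_betw \<sigma> {..<n} {..<n} \<longrightarrow> (\<Sum>q<n. c q (\<mu> q)) \<le> (\<Sum>q<n. c q (\<sigma> q)))) s"
proof -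
  define J where "J m s' \<longleftrightarrow> (\<exists>k u v S T M B. represents s' k u v S T M \<and>
    tree k u v S T M B \<and> feasible u v \<and> m = variant k S)" for m s'
  have n: "s 0 1 = int n" using cs by (simp add: cost_stored_def)
  let ?s = "upd s arr_S 0 1"
  have "wp N L (While (Less (Var var_k) exp_n) step_com) (\<lambda>s'. \<exists>\<mu>. bij_betw \<mu> {..<n} {..<n} \<and>
    (\<forall>q<n. s' arr_M (int n * int n + int q) = int (\<mu> q)) \<and>
    (\<forall>\<sigma>. bij_betw \<sigma> {..<n} {..<n} \<longrightarrow> (\<Sum>q<n. c q (\<mu> q)) \<le> (\<Sum>q<n. c q (\<sigma> q)))) ?s"
  proof (rule wp_While[where I = J and m = "variant 0 {0}"], goal_cases)
    case 1
    have "represents ?s 0 (\<lambda>_. 0) (\<lambda>_. 0) {0} {} (\<lambda>_ _. 0)"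
      using zero by (simp add: represents_def)
    then show ?case unfolding J_def using tree_init feasible_init by blast
  next
    case 2
    show ?case using N_ge by (simp add: variant_def)
  next
    case (3 m s')
    then obtain k u v S T M B where J: "represents s' k u v S T M" "tree k u v S T M B"
      "feasible u v" "m = variant k S" unfolding J_def by blast
    have cs': "cost_stored s'"
      using cs 3(4) by (simp add: cost_stored_def step_com_def modified_step_coms)
    then have "k < n" using 3(2) J(1) by (simp add: cost_stored_def represents_def)
    show ?case
      by (rule wp_conseq[OF step_correct[OF cs' J(1-3) \<open>k < n\<close>]])
        (use J(4) in \<open>unfold J_def, blast\<close>)
  next
    case (4 m s')
    then obtain k u v S T M B where J: "represents s' k u v S T M" "tree k u v S T M B"
      "feasible u v" unfolding J_def by blast
    have "s' 0 = s 0" using 4(4) by (simp add: step_com_def modified_step_coms)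
    then have "k = n" using 4(2) J(1) n treeD(1)[OF J(2)] by (simp add: represents_def)
    with J have J': "represents s' n u v S T M" "tree n u v S T M B" by simp_all
    show ?case
      using J'(1) tree_optimal[OF J'(2) J(3)]
      by (intro exI[of _ "M n"]) (simp add: represents_def)
  qed
  then show ?thesis
    unfolding hungarian_com_def using L_ge
    by (intro wp_Seq wp_Assign) simp_all
qed

end

section \<open>Scaling the input and computing the cost matrix\<close>

abbreviation (input) "exp_m \<equiv> Add (Add exp_n exp_K) (Mul exp_n exp_K)"

text \<open>Cells 0 to 2 of the input hold its length, \<open>n\<close> and \<open>K\<close>, so
  entry \<open>x\<close> has its numerator in cell \<open>2 * x + 3\<close> and its denominator in
  the next one.\<close>

definition scale_com :: com where
  "scale_com = For var_e (Add exp_m (Const 1))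
     (Seq (Set var_acc (Const 1)) (Seq
       (For var_x exp_m (Cond (Equal (Var var_x) (Var var_e))
         (Set var_acc (Mul (Var var_acc) (Cell 0 (Add (Mul (Const 2) (Var var_x)) (Const 3)))))
         (Set var_acc (Mul (Var var_acc) (Cell 0 (Add (Mul (Const 2) (Var var_x)) (Const 4)))))))
       (Assign arr_Q (Var var_e) (Var var_acc))))"

definition due_exp :: aexp where
  "due_exp = Cell arr_Q (Add (Add exp_n exp_K) (Add (Mul (Var var_i) exp_n) (Var var_j)))"

definition completion_exp :: aexp where
  "completion_exp = Mul (Add (Var var_t) (Const 1)) (Cell arr_Q exp_m)"

text \<open>The flag \<open>unit\<close> selects the number of late jobs; otherwise the tardiness is counted.\<close>

definition penalty_exp :: "bool \<Rightarrow> aexp" where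
  "penalty_exp unit = (if unit then Const 1 else Sub completion_exp due_exp)"

definition cost_com :: "bool \<Rightarrow> com" where
  "cost_com unit = For var_t exp_n (For var_j exp_n
     (Seq (Set var_acc (Const 0)) (Seq
       (For var_i exp_K (Cond (Less due_exp completion_exp)
         (Set var_acc (Add (Var var_acc)
            (Mul (Cell arr_Q (Add exp_n (Var var_i))) (penalty_exp unit)))) Skip))
       (Assign arr_C (Add (Mul (Var var_t) exp_n) (Var var_j))
         (Mul (Var var_acc) (Cell arr_Q (Var var_j)))))))"

definition output_com :: com where
  "output_com = Seq (Assign 1 (Const 0) exp_n)
     (For var_t exp_n (Assign 1 (Add (Var var_t) (Const 1)) (Cell2 arr_M exp_n (Var var_t))))"

definition program :: "bool \<Rightarrow> com" where
  "program unit = Seq scale_com (Seq (cost_com unit) (Seq hungarian_com output_com))"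

text \<open>\<open>z\<close> is the input size. Bounding the sum of all sizes, not just each size,
  is what keeps the product of all denominators below \<open>2 ^ z\<close>.\<close>

locale scaled_input =
  fixes n K z :: nat and num den :: "nat \<Rightarrow> int"
  assumes length_less: "n + K + n * K < z"
    and sizes_le: "(\<Sum>e<n + K + n * K. int_size (num e) + int_size (den e)) \<le> z"
    and num_nonneg: "\<And>e. e < n + K + n * K \<Longrightarrow> 0 \<le> num e"
    and den_pos: "\<And>e. e < n + K + n * K \<Longrightarrow> 0 < den e"
begin

definition m :: nat where "m = n + K + n * K"

definition Z :: int where "Z = 2 ^ z"

definition N :: nat where "N = (z + 1)\<^sup>2"

text \<open>Five factors \<open>Z\<close> bound a cost entry: the weight, the number of scenarios,
  the probability, and two for the penalty \<open>(t + 1) * Q m\<close>. The factor 4 is the one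
  required in \<open>assignment_ram\<close> and keeps \<open>L\<close> a power of two.\<close>

definition L :: int where "L = 4 * Z ^ 5"

text \<open>
  The machine has no division, so each rational is scaled by the product of all denominators:
  in that product the denominator of the entry itself is replaced by its numerator. The index \<open>m\<close>
  matches no entry and yields the common denominator.
\<close>

definition Q :: "nat \<Rightarrow> int" where
  "Q e = (\<Prod>x<m. if x = e then num x else den x)"

lemma z_le_Z: "int z \<le> Z"
  unfolding Z_def by (metis less_exp less_imp_le of_nat_le_iff of_nat_numeral of_nat_power)

lemma Z_pos: "1 \<le> Z" by (simp add: Z_def)

lemma Z_le_L: "Z ^ 4 \<le> L" "Z \<le> L"
proof -
  have "Z ^ 4 \<le> Z ^ 5" "Z ^ 1 \<le> Z ^ 5" using Z_pos by (intro power_increasing; simp)+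
  moreover have "Z ^ 5 \<le> L" using Z_pos by (simp add: L_def)
  ultimately show "Z ^ 4 \<le> L" "Z \<le> L" by simp_all
qed

lemma m_le: "m + 1 \<le> z" "n \<le> z" "K \<le> z"
  using length_less by (simp_all add: m_def)

lemma le_N: "k \<le> z \<Longrightarrow> k \<le> N"
  by (simp add: N_def power2_eq_square)

lemma le_L: "k \<le> z \<Longrightarrow> int k \<le> L"
  using z_le_Z Z_le_L by linarith

text \<open>Stated for prefixes because the accumulator runs through them. Whether numerator or
  denominator is chosen, each factor is at most 2 to the power of both sizes together.\<close>

lemma partial_product_bounds:
  assumes "p \<le> m"
  shows "0 \<le> (\<Prod>x<p. if x = e then num x else den x)"
    "(\<Prod>x<p. if x = e then num x else den x) \<le> Z"
proof -
  have nn: "0 \<le> num x" "0 < den x" if "x < p" for x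
    using that assms num_nonneg den_pos by (simp_all add: m_def)
  show "0 \<le> (\<Prod>x<p. if x = e then num x else den x)"
    by (intro prod_nonneg) (simp add: nn less_imp_le)
  have "(\<Prod>x<p. if x = e then num x else den x) \<le> (\<Prod>x<p. 2 ^ (int_size (num x) + int_size (den x)))"
  proof (intro prod_mono conjI)
    fix x assume "x \<in> {..<p}"
    then show "0 \<le> (if x = e then num x else den x)" using nn by (simp add: less_imp_le)
    have "num x \<le> 2 ^ int_size (num x)" "den x \<le> 2 ^ int_size (den x)"
      using abs_le_int_size abs_ge_self order_trans by blast+
    moreover have "(2::int) ^ int_size (num x) \<le> 2 ^ (int_size (num x) + int_size (den x))"
      "(2::int) ^ int_size (den x) \<le> 2 ^ (int_size (num x) + int_size (den x))"
      by (intro power_increasing; simp)+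
    ultimately show "(if x = e then num x else den x) \<le> 2 ^ (int_size (num x) + int_size (den x))"
      by (smt (verit))
  qed
  also have "\<dots> = 2 ^ (\<Sum>x<p. int_size (num x) + int_size (den x))"
    by (simp add: power_sum)
  also have "\<dots> \<le> Z"
  proof -
    have "(\<Sum>x<p. int_size (num x) + int_size (den x)) \<le> (\<Sum>x<m. int_size (num x) + int_size (den x))"
      using assms by (intro sum_mono2) auto
    with sizes_le show ?thesis unfolding Z_def m_def by (intro power_increasing) auto
  qed
  finally show "(\<Prod>x<p. if x = e then num x else den x) \<le> Z" .
qed

lemma Q_bounds: "0 \<le> Q e" "Q e \<le> Z"
  using partial_product_bounds[of m e] by (simp_all add: Q_def)

lemma Q_m: "Q m = (\<Prod>x<m. den x)"
  unfolding Q_def by (intro prod.cong) auto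

lemma Q_m_pos: "0 < Q m"
  unfolding Q_m using den_pos by (intro prod_pos) (simp add: m_def)

lemma Q_eq: "e < m \<Longrightarrow> Q e * den e = num e * Q m"
proof -
  assume "e < m"
  then have e: "e \<in> {..<m}" by simp
  have "Q e = num e * (\<Prod>x\<in>{..<m} - {e}. if x = e then num x else den x)"
    unfolding Q_def by (subst prod.remove[OF _ e]) simp_all
  also have "(\<Prod>x\<in>{..<m} - {e}. if x = e then num x else den x) = (\<Prod>x\<in>{..<m} - {e}. den x)"
    by (intro prod.cong) auto
  finally have "Q e = num e * (\<Prod>x\<in>{..<m} - {e}. den x)" .
  moreover have "Q m = den e * (\<Prod>x\<in>{..<m} - {e}. den x)"
    unfolding Q_m by (subst prod.remove[OF _ e]) simp_all
  ultimately show ?thesis by simp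
qed

definition input_stored :: "store \<Rightarrow> bool" where
  "input_stored s \<longleftrightarrow> s 0 1 = int n \<and> s 0 2 = int K \<and>
     (\<forall>e<m. s 0 (2 * int e + 3) = num e \<and> s 0 (2 * int e + 4) = den e)"

lemma scale_correct:
  assumes "input_stored s"
  shows "wp N L scale_com (\<lambda>s'. \<forall>e\<le>m. s' arr_Q (int e) = Q e) s"
proof -
  have inp: "s 0 1 = int n" "s 0 2 = int K"
    "\<And>e. e < m \<Longrightarrow> s 0 (2 * int e + 3) = num e" "\<And>e. e < m \<Longrightarrow> s 0 (2 * int e + 4) = den e"
    using assms by (simp_all add: input_stored_def)
  define inner where "inner = For var_x exp_m (Cond (Equal (Var var_x) (Var var_e))
         (Set var_acc (Mul (Var var_acc) (Cell 0 (Add (Mul (Const 2) (Var var_x)) (Const 3)))))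
         (Set var_acc (Mul (Var var_acc) (Cell 0 (Add (Mul (Const 2) (Var var_x)) (Const 4))))))"
  have mod_inner: "modified inner = {var_x, var_acc}" by (simp add: inner_def)
  have inner: "wp N L inner (\<lambda>s'. s' var_acc 0 = Q e) s'"
    if "s' 0 = s 0" "s' var_e 0 = int e" "s' var_acc 0 = 1" for e s'
    unfolding inner_def
  proof (rule wp_For[where m = m and
      I = "\<lambda>p s'. s' var_acc 0 = (\<Prod>x<p. if x = e then num x else den x)"], goal_cases)
    case (7 p s'')
    let ?P = "\<lambda>p. \<Prod>x<p. if x = e then num x else den x"
    have "s'' 0 = s 0" "s'' var_e 0 = int e" using 7(5) that by simp_all
    moreover have "\<bar>?P (Suc p)\<bar> \<le> L"
      using partial_product_bounds[of "Suc p" e] 7(1) Z_le_L by simp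
    ultimately show ?case using 7(1-3) inp
      by (intro wp_Cond wp_Assign) auto
  next
    case (8 s'')
    then show ?case by (simp add: Q_def)
  qed (use that inp m_le le_N[of m] le_L[of m] in \<open>simp_all add: m_def\<close>)
  show ?thesis
    unfolding scale_com_def inner_def[symmetric]
  proof (rule wp_For[where m = "m + 1" and I = "\<lambda>p s'. \<forall>e<p. s' arr_Q (int e) = Q e"], goal_cases)
    case (7 p s')
    show ?case
    proof (intro wp_Seq wp_Assign, goal_cases)
      case 1
      show ?case using Z_le_L Z_pos by simp
    next
      case 2
      have "wp N L inner (\<lambda>s'. s' var_acc 0 = Q p) (upd s' var_acc 0 1)"
        using 7 mod_inner by (intro inner) simp_all
      then show ?case
        using 7 Q_bounds[of p] Z_le_L
        by (auto elim!: wp_conseq intro!: wp_Assign simp: mod_inner less_Suc_eq)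
    qed
  qed (use mod_inner inp m_le le_N[of "m + 1"] le_L[of "m + 1"] in \<open>simp_all add: m_def\<close>)
qed

text \<open>Time is measured in units of \<open>1 / Q m\<close>, so the lateness test compares
  integers.\<close>

definition penalty :: "bool \<Rightarrow> nat \<Rightarrow> nat \<Rightarrow> nat \<Rightarrow> int" where
  "penalty unit t i j = (let C = (int t + 1) * Q m; D = Q (n + K + (i * n + j)) in
     if D < C then if unit then 1 else C - D else 0)"

definition cost :: "bool \<Rightarrow> nat \<Rightarrow> nat \<Rightarrow> int" where
  "cost unit t j = (\<Sum>i<K. Q (n + i) * penalty unit t i j) * Q j"

lemma penalty_bounds: "t < n \<Longrightarrow> 0 \<le> penalty unit t i j \<and> penalty unit t i j \<le> Z\<^sup>2"
proof -
  assume t: "t < n"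
  have "(int t + 1) * Q m \<le> Z * Z"
    using t m_le(2) z_le_Z Z_pos Q_bounds[of m] by (intro mult_mono) auto
  then show ?thesis
    using Q_bounds[of "n + K + (i * n + j)"] Z_pos one_le_power[OF Z_pos, of 2]
    by (auto simp: penalty_def Let_def power2_eq_square)
qed

lemma partial_sum_bounds:
  assumes "t < n" "p \<le> K"
  shows "0 \<le> (\<Sum>i<p. Q (n + i) * penalty unit t i j)"
    "(\<Sum>i<p. Q (n + i) * penalty unit t i j) \<le> Z ^ 4"
proof -
  have b: "0 \<le> Q (n + i) * penalty unit t i j" "Q (n + i) * penalty unit t i j \<le> Z * Z\<^sup>2" for i
    using Q_bounds[of "n + i"] penalty_bounds[OF assms(1), of unit i j] Z_pos
    by (auto intro!: mult_mono)
  show "0 \<le> (\<Sum>i<p. Q (n + i) * penalty unit t i j)" using b by (intro sum_nonneg) auto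
  have "(\<Sum>i<p. Q (n + i) * penalty unit t i j) \<le> (\<Sum>i<p. Z * Z\<^sup>2)" using b by (intro sum_mono)
  also have "\<dots> = int p * (Z * Z\<^sup>2)" by simp
  also have "\<dots> \<le> Z * (Z * Z\<^sup>2)"
    using assms(2) m_le(3) z_le_Z Z_pos by (intro mult_right_mono) auto
  also have "\<dots> = Z ^ 4" by (simp add: power2_eq_square eval_nat_numeral)
  finally show "(\<Sum>i<p. Q (n + i) * penalty unit t i j) \<le> Z ^ 4" .
qed

lemma cost_bounds:
  assumes "t < n"
  shows "0 \<le> cost unit t j" "cost unit t j \<le> Z ^ 5"
proof -
  note b = partial_sum_bounds[OF assms order_refl, of unit j]
  show "0 \<le> cost unit t j" using b Q_bounds by (simp add: cost_def)
  have "cost unit t j \<le> Z ^ 4 * Z"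
    unfolding cost_def using b Q_bounds[of j] Z_pos by (intro mult_mono) auto
  then show "cost unit t j \<le> Z ^ 5" by (simp add: eval_nat_numeral mult.commute mult.left_commute)
qed

lemma cost_correct:
  assumes "s 0 1 = int n" "s 0 2 = int K" and Q: "\<forall>e\<le>m. s arr_Q (int e) = Q e"
  shows "wp N L (cost_com unit)
    (\<lambda>s'. \<forall>t<n. \<forall>j<n. s' arr_C (int t * int n + int j) = cost unit t j) s"
proof -
  define inner where "inner = For var_i exp_K (Cond (Less due_exp completion_exp)
         (Set var_acc (Add (Var var_acc)
            (Mul (Cell arr_Q (Add exp_n (Var var_i))) (penalty_exp unit)))) Skip)"
  define body where "body = Seq (Set var_acc (Const 0)) (Seq inner
       (Assign arr_C (Add (Mul (Var var_t) exp_n) (Var var_j))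
         (Mul (Var var_acc) (Cell arr_Q (Var var_j)))))"
  have mod_inner: "modified inner = {var_i, var_acc}" by (auto simp: inner_def)
  have mod_body: "modified body = {arr_C, var_i, var_acc}" by (auto simp: body_def mod_inner)
  have inner: "wp N L inner (\<lambda>s'. s' var_acc 0 = (\<Sum>i<K. Q (n + i) * penalty unit t i j)) s'"
    if "s' 0 = s 0" "s' arr_Q = s arr_Q" "s' var_t 0 = int t" "s' var_j 0 = int j"
      "s' var_acc 0 = 0" "t < n" "j < n" for t j s'
    unfolding inner_def
  proof (rule wp_For[where m = K and
      I = "\<lambda>p s'. s' var_acc 0 = (\<Sum>i<p. Q (n + i) * penalty unit t i j)"], goal_cases)
    case (7 i s'')
    have s'': "s'' 0 = s 0" "s'' arr_Q = s arr_Q" "s'' var_t 0 = int t" "s'' var_j 0 = int j"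
      using 7(5) that by simp_all
    have "i * n + j < (i + 1) * n" using \<open>j < n\<close> by simp
    also have "\<dots> \<le> K * n" using 7(1) by (intro mult_right_mono) auto
    finally have "n + K + (i * n + j) \<le> m" by (simp add: m_def mult.commute)
    with Q have "s arr_Q (int (n + K + (i * n + j))) = Q (n + K + (i * n + j))" by blast
    then have due: "aval due_exp s'' = Q (n + K + (i * n + j))"
      using s'' 7(2) assms(1,2) by (simp add: due_exp_def)
    have "s arr_Q (int m) = Q m" using Q by blast
    then have compl: "aval completion_exp s'' = (int t + 1) * Q m"
      using s'' assms(1,2) by (simp add: completion_exp_def m_def)
    have "n + i \<le> m" using 7(1) by (simp add: m_def)
    with Q have "s arr_Q (int (n + i)) = Q (n + i)" by blast
    then have pr: "s arr_Q (int n + int i) = Q (n + i)" by simp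
    have bd: "\<bar>\<Sum>i<Suc i. Q (n + i) * penalty unit t i j\<bar> \<le> L"
      using partial_sum_bounds[OF \<open>t < n\<close>, of "Suc i" unit j] 7(1) Z_le_L by simp
    show ?case
    proof (rule wp_Cond, goal_cases)
      case 1
      then have "aval (penalty_exp unit) s'' = penalty unit t i j"
        using due compl by (simp add: penalty_exp_def penalty_def)
      then show ?case using 7(2,3) s'' pr bd assms(1) by (intro wp_Assign) simp_all
    next
      case 2
      then have "penalty unit t i j = 0" using due compl by (simp add: penalty_def)
      then show ?case using 7(3) by (intro wp_Skip) simp
    qed
  qed (use that assms m_le le_N[of K] le_L[of K] in simp_all)
  \<comment> \<open>Specifying the update of the whole array, not just the new entry, preserves the
    entries computed earlier.\<close>
  have body: "wp N L body (\<lambda>s''. s'' arr_C = (s' arr_C)(int t * int n + int j := cost unit t j)) s'"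
    if "s' 0 = s 0" "s' arr_Q = s arr_Q" "s' var_t 0 = int t" "s' var_j 0 = int j"
      "t < n" "j < n" for t j s'
    unfolding body_def
  proof (intro wp_Seq wp_Assign, goal_cases)
    case 1
    show ?case using Z_le_L Z_pos by simp
  next
    case 2
    have Qj: "s arr_Q (int j) = Q j" using Q that by (simp add: m_def)
    have "\<bar>cost unit t j\<bar> \<le> L" using cost_bounds[OF \<open>t < n\<close>, of unit j] Z_pos by (simp add: L_def)
    moreover have "wp N L inner (\<lambda>s'. s' var_acc 0 = (\<Sum>i<K. Q (n + i) * penalty unit t i j))
      (upd s' var_acc 0 0)" using that by (intro inner) simp_all
    ultimately show ?case using that Qj assms(1)
      by (auto elim!: wp_conseq intro!: wp_Assign simp: mod_inner cost_def)
  qed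
  have row: "wp N L (For var_j exp_n body) (\<lambda>s''. \<forall>t'<Suc t. \<forall>j'<n.
      s'' arr_C (int t' * int n + int j') = cost unit t' j') s'"
    if "s' 0 = s 0" "s' arr_Q = s arr_Q" "s' var_t 0 = int t" "t < n"
      "\<forall>t'<t. \<forall>j'<n. s' arr_C (int t' * int n + int j') = cost unit t' j'" for t s'
  proof (rule wp_For[where m = n and I = "\<lambda>p s''. \<forall>t' j'. j' < n \<longrightarrow> t' < t \<or> t' = t \<and> j' < p \<longrightarrow>
      s'' arr_C (int t' * int n + int j') = cost unit t' j'"], goal_cases)
    case (7 j s'')
    have "wp N L body (\<lambda>s3. s3 arr_C = (s'' arr_C)(int t * int n + int j := cost unit t j)) s''"
      using 7 that by (intro body) (simp_all add: mod_body)
    then show ?case by (rule wp_conseq) (use 7(1,3) in \<open>auto simp: less_Suc_eq\<close>)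
  next
    case (8 s'')
    then show ?case by (auto simp: less_Suc_eq)
  qed (use that assms m_le le_N[of n] le_L[of n] mod_body in simp_all)
  show ?thesis
    unfolding cost_com_def inner_def[symmetric] body_def[symmetric]
  proof (rule wp_For[where m = n and I = "\<lambda>p s'. \<forall>t<p. \<forall>j<n.
      s' arr_C (int t * int n + int j) = cost unit t j"], goal_cases)
    case (7 t s')
    then show ?case by (intro row) (simp_all add: mod_body)
  qed (use assms m_le le_N[of n] le_L[of n] mod_body in simp_all)
qed

lemma output_correct:
  assumes "s 0 1 = int n" and "\<forall>q<n. s arr_M (int n * int n + int q) = int (\<mu> q)"
    and "\<And>q. q < n \<Longrightarrow> \<mu> q < n"
  shows "wp N L output_com (\<lambda>s'. has_output s' (map int (map \<mu> [0..<n]))) s"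
proof -
  have "wp N L (For var_t exp_n (Assign 1 (Add (Var var_t) (Const 1)) (Cell2 arr_M exp_n (Var var_t))))
    (\<lambda>s'. has_output s' (map int (map \<mu> [0..<n]))) (upd s 1 0 (int n))"
  proof (rule wp_For[where m = n and
      I = "\<lambda>p s'. s' 1 0 = int n \<and> (\<forall>q<p. s' 1 (int q + 1) = int (\<mu> q))"], goal_cases)
    case (7 q s')
    have "int (\<mu> q) \<le> L" using assms(3)[OF 7(1)] le_L[of n] m_le by simp
    then show ?case using 7 assms(1,2) by (intro wp_Assign) (auto simp: less_Suc_eq)
  next
    case (8 s')
    then show ?case by (simp add: has_output_def)
  qed (use assms m_le le_N[of n] le_L[of n] in simp_all)
  then show ?thesis
    unfolding output_com_def using assms(1) le_L[of n] m_le by (intro wp_Seq wp_Assign) simp_all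
qed

text \<open>Since rows are positions, the list of matched columns is the schedule itself and needs
  no inversion.\<close>

lemma program_correct:
  assumes "input_stored s" and zero: "\<And>x i. 0 < x \<Longrightarrow> s x i = 0"
  shows "wp N L (program unit) (\<lambda>s'. \<exists>\<mu>. bij_betw \<mu> {..<n} {..<n} \<and>
    has_output s' (map int (map \<mu> [0..<n])) \<and>
    (\<forall>\<sigma>. bij_betw \<sigma> {..<n} {..<n} \<longrightarrow>
      (\<Sum>q<n. cost unit q (\<mu> q)) \<le> (\<Sum>q<n. cost unit q (\<sigma> q)))) s"
proof -
  interpret H: assignment_ram n "cost unit" "Z ^ 5" N L
  proof
    show "(n + 1)\<^sup>2 \<le> N" unfolding N_def using m_le by (intro power_mono) auto
    show "int n + 1 \<le> L" using le_L[of "n + 1"] m_le length_less by simp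
  qed (simp_all add: cost_bounds L_def)
  have inp: "s 0 1 = int n" "s 0 2 = int K" using assms(1) by (simp_all add: input_stored_def)
  have mods: "modified scale_com = {arr_Q, var_e, var_x, var_acc}"
    "modified (cost_com unit) = {arr_C, var_t, var_j, var_i, var_acc}"
    by (auto simp: scale_com_def cost_com_def)
  have modh: "0 \<notin> modified hungarian_com"
    by (simp add: hungarian_com_def step_com_def modified_step_coms)
  show ?thesis
    unfolding program_def
  proof (rule wp_Seq, rule wp_conseq[OF scale_correct[OF assms(1)]], goal_cases)
    case (1 s1)
    have i1: "s1 0 1 = int n" "s1 0 2 = int K" using 1(2) inp by (simp_all add: mods)
    show ?case
    proof (rule wp_Seq, rule wp_conseq[OF cost_correct[OF i1 1(3)]], goal_cases)
      case (1 s2)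
      have cs: "H.cost_stored s2" using i1 1(2,3) by (simp add: H.cost_stored_def mods)
      have z2: "s2 x i = 0" if "x \<in> {arr_u, arr_v, arr_S, arr_T, arr_M, var_k}" for x i
        using that 1(2) \<open>\<forall>x. x \<notin> modified scale_com \<longrightarrow> _\<close> zero by (auto simp: mods)
      show ?case
      proof (rule wp_Seq, rule wp_conseq[OF H.hungarian_correct[OF cs z2]], assumption,
          elim exE conjE, goal_cases)
        case (1 s3 \<mu>)
        have "s3 0 1 = int n" using cs 1(2) modh by (simp add: H.cost_stored_def)
        then have "wp N L output_com (\<lambda>s'. has_output s' (map int (map \<mu> [0..<n]))) s3"
          using 1(4) bij_betwE[OF 1(3)] by (intro output_correct) auto
        then show ?case by (rule wp_conseq) (use 1(3,5) in blast)
      qed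
    qed
  qed
qed

end

section \<open>Expected costs and encoded instances\<close>

definition objective :: "bool \<Rightarrow> sched_inst \<Rightarrow> nat list \<Rightarrow> nat \<Rightarrow> rat" where
  "objective unit = (if unit then sum_wU else sum_wT)"

text \<open>\<open>max 0 (C - d)\<close> becomes a conditional on \<open>d < C\<close>, so both
  objectives share one test, as in the program.\<close>

definition lateness_penalty :: "bool \<Rightarrow> rat \<Rightarrow> rat \<Rightarrow> rat" where
  "lateness_penalty unit C d = (if d < C then if unit then 1 else C - d else 0)"

lemma completion_nth:
  assumes "distinct \<pi>" "t < length \<pi>"
  shows "completion \<pi> (\<pi> ! t) = of_nat t + 1"
proof -
  have "takeWhile (\<lambda>i. i \<noteq> \<pi> ! t) \<pi> = take t \<pi>"
    using assms by (intro takeWhile_eq_take_P_nth) (auto simp: nth_eq_iff_index_eq)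
  then show ?thesis
    using assms by (simp add: completion_def proc_time_def sum_list_triv)
qed

lemma schedules_nth_bij:
  assumes "\<pi> \<in> schedules I"
  shows "length \<pi> = njobs I" "distinct \<pi>" "bij_betw (nth \<pi>) {..<njobs I} {..<njobs I}"
proof -
  have p: "set \<pi> = {..<njobs I}" "distinct \<pi>"
    using assms by (auto simp: schedules_def permutations_of_set_def)
  then show "length \<pi> = njobs I" "distinct \<pi>" using distinct_card[OF p(2)] by simp_all
  then show "bij_betw (nth \<pi>) {..<njobs I} {..<njobs I}" using p(1) by (intro bij_betw_nth) simp_all
qed

lemma expected_cost_eq:
  assumes "\<pi> \<in> schedules I"
  shows "expected_cost (objective unit) I \<pi> = (\<Sum>t<njobs I. weight I (\<pi> ! t) *
    (\<Sum>i<nscen I. prob I i * lateness_penalty unit (of_nat t + 1) (due I i (\<pi> ! t))))"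
proof -
  note p = schedules_nth_bij[OF assms]
  have "objective unit I \<pi> i = (\<Sum>j<njobs I. weight I j *
      lateness_penalty unit (completion \<pi> j) (due I i j))" for i
    by (auto simp: objective_def sum_wU_def sum_wT_def unit_penalty_def tardiness_def
        lateness_penalty_def intro!: sum.cong)
  also have "(\<Sum>j<njobs I. weight I j * lateness_penalty unit (completion \<pi> j) (due I i j)) =
      (\<Sum>t<njobs I. weight I (\<pi> ! t) *
        lateness_penalty unit (completion \<pi> (\<pi> ! t)) (due I i (\<pi> ! t)))" for i
    by (rule sum.reindex_bij_betw[OF p(3), symmetric])
  also have "\<dots> i = (\<Sum>t<njobs I. weight I (\<pi> ! t) *
        lateness_penalty unit (of_nat t + 1) (due I i (\<pi> ! t)))" for i
    using p(1,2) by (intro sum.cong) (simp_all add: completion_nth)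
  finally have "expected_cost (objective unit) I \<pi> = (\<Sum>i<nscen I. \<Sum>t<njobs I.
      weight I (\<pi> ! t) * (prob I i * lateness_penalty unit (of_nat t + 1) (due I i (\<pi> ! t))))"
    by (simp add: expected_cost_def sum_distrib_left mult.left_commute)
  then show ?thesis by (subst (asm) sum.swap) (simp add: sum_distrib_left)
qed

section \<open>Positions of the rationals in the encoding\<close>

definition entries :: "sched_inst \<Rightarrow> rat list" where
  "entries I = map (weight I) [0..<njobs I] @ map (prob I) [0..<nscen I] @
     concat (map (\<lambda>i. map (due I i) [0..<njobs I]) [0..<nscen I])"

lemma concat_map_concat: "concat (map f (concat xss)) = concat (map (\<lambda>xs. concat (map f xs)) xss)"
  by (induction xss) simp_all

lemma encode_inst_eq:
  "encode_inst I = int (njobs I) # int (nscen I) # concat (map encode_rat (entries I))"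
  by (simp add: encode_inst_def entries_def concat_map_concat comp_def)

lemma length_concat_rows: "length (concat (map (\<lambda>i. map (f i) [0..<n]) [0..<k])) = k * n"
  by (induction k) simp_all

lemma nth_concat_rows:
  "i < k \<Longrightarrow> j < n \<Longrightarrow> concat (map (\<lambda>i. map (f i) [0..<n]) [0..<k]) ! (i * n + j) = f i j"
proof (induction k)
  case (Suc k)
  show ?case
  proof (cases "i < k")
    case True
    have "i * n + j < (i + 1) * n" using Suc.prems by simp
    also have "\<dots> \<le> k * n" using True by (intro mult_right_mono) auto
    finally show ?thesis using Suc True by (simp add: nth_append length_concat_rows)
  next
    case False
    with Suc.prems have "i = k" by simp
    with Suc.prems show ?thesis by (simp add: nth_append length_concat_rows)
  qed
qed simp

lemma length_entries: "length (entries I) = njobs I + nscen I + njobs I * nscen I"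
  by (simp add: entries_def length_concat_rows mult.commute)

lemma entries_nth:
  shows "j < njobs I \<Longrightarrow> entries I ! j = weight I j"
    and "i < nscen I \<Longrightarrow> entries I ! (njobs I + i) = prob I i"
    and "i < nscen I \<Longrightarrow> j < njobs I \<Longrightarrow>
      entries I ! (njobs I + nscen I + (i * njobs I + j)) = due I i j"
  by (simp_all add: entries_def nth_append nth_concat_rows)

lemma length_concat_encode_rat: "length (concat (map encode_rat qs)) = 2 * length qs"
  by (induction qs) (simp_all add: encode_rat_def)

lemma nth_concat_encode_rat:
  "e < length qs \<Longrightarrow> concat (map encode_rat qs) ! (2 * e) = fst (quotient_of (qs ! e)) \<and>
     concat (map encode_rat qs) ! (2 * e + 1) = snd (quotient_of (qs ! e))"
proof (induction qs arbitrary: e)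
  case (Cons q qs)
  then show ?case by (cases e) (simp_all add: encode_rat_def)
qed simp

lemma input_size_concat_encode_rat:
  "input_size (concat (map encode_rat qs)) =
     (\<Sum>e<length qs. int_size (fst (quotient_of (qs ! e))) + int_size (snd (quotient_of (qs ! e))))"
  by (induction qs rule: rev_induct)
    (simp_all add: input_size_def encode_rat_def nth_append)

lemma quotient_of_nonneg: "0 \<le> q \<Longrightarrow> 0 \<le> fst (quotient_of q)"
proof -
  assume q: "0 \<le> q"
  obtain a b where ab: "quotient_of q = (a, b)" by fastforce
  then have "0 < b" "q = of_int a / of_int b"
    using quotient_of_denom_pos quotient_of_div by auto
  with q ab show ?thesis by (simp add: zero_le_divide_iff)
qed

text \<open>There are \<open>k + 1\<close> binary digits and a sign bit.\<close>

lemma int_size_power2: "int_size (2 ^ k) = k + 2"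
  using int_size_le_iff[of "2 ^ k" "Suc k"] int_size_le_iff[of "2 ^ k" k] by simp

lemma encode_inst_scaled_input:
  assumes "I \<in> sched_instances"
  shows "scaled_input (njobs I) (nscen I) (input_size (encode_inst I))
    (\<lambda>e. fst (quotient_of (entries I ! e))) (\<lambda>e. snd (quotient_of (entries I ! e)))"
proof
  let ?n = "njobs I" and ?K = "nscen I"
  let ?s = "\<lambda>e. int_size (fst (quotient_of (entries I ! e))) + int_size (snd (quotient_of (entries I ! e)))"
  have size: "input_size (encode_inst I) =
      int_size (int ?n) + int_size (int ?K) + (\<Sum>e<?n + ?K + ?n * ?K. ?s e)"
    using input_size_concat_encode_rat[of "entries I"]
    by (simp add: encode_inst_eq input_size_def length_entries)
  then show "(\<Sum>e<?n + ?K + ?n * ?K. ?s e) \<le> input_size (encode_inst I)" by simp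
  \<comment> \<open>Each entry contributes at least 1 to the size; the leading number of jobs makes
    the inequality strict.\<close>
  have "?n + ?K + ?n * ?K = (\<Sum>e<?n + ?K + ?n * ?K. 1)" by simp
  also have "\<dots> \<le> (\<Sum>e<?n + ?K + ?n * ?K. ?s e)"
    using int_size_pos by (intro sum_mono) (simp add: trans_le_add1)
  finally show "?n + ?K + ?n * ?K < input_size (encode_inst I)"
    using size int_size_pos[of "int ?n"] by simp
  fix e assume "e < ?n + ?K + ?n * ?K"
  then have "entries I ! e \<in> set (entries I)" by (simp add: length_entries)
  then have "0 \<le> entries I ! e"
    using assms by (auto simp: entries_def sched_instances_def less_imp_le)
  then show "0 \<le> fst (quotient_of (entries I ! e))" by (rule quotient_of_nonneg)
  show "0 < snd (quotient_of (entries I ! e))" by (rule quotient_of_denom_pos')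
qed

lemma length_le_input_size: "length xs \<le> input_size xs"
proof (induction xs)
  case (Cons x xs)
  then show ?case using int_size_pos[of x] by (simp add: input_size_def)
qed simp

text \<open>\<open>wp\<close> promises something only for bounded stores, so the initial store has
  to be shown to be one.\<close>

lemma bounded_input_store:
  assumes "int (length xs) \<le> B" "2 ^ input_size xs \<le> B"
  shows "bounded_store B (input_store xs)"
  unfolding bounded_store_def
proof (intro allI)
  fix x i
  have "\<bar>y\<bar> \<le> B" if "y \<in> set xs" for y
  proof -
    have "int_size y \<le> input_size xs"
      unfolding input_size_def using that by (intro member_le_sum_list) auto
    then have "(2::int) ^ int_size y \<le> 2 ^ input_size xs" by (intro power_increasing) auto
    with abs_le_int_size[of y] assms(2) show ?thesis by linarith
  qed
  moreover have "xs ! nat (i - 1) \<in> set xs" if "1 \<le> i" "i \<le> int (length xs)"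
    using that by (intro nth_mem) auto
  ultimately show "\<bar>input_store xs x i\<bar> \<le> B"
    using assms(1) by (auto simp: input_store_def)
qed

lemma program_solves:
  assumes I: "I \<in> sched_instances"
  defines "z \<equiv> input_size (encode_inst I)"
  shows "\<exists>t s y. exec (program unit) (input_store (encode_inst I)) t s \<and>
    t \<le> time_bound ((z + 1)\<^sup>2) (5 * z + 4) (program unit) \<and>
    has_output s (encode_schedule y) \<and> min_exp (objective unit) I y"
proof -
  define n where "n = njobs I"
  define K where "K = nscen I"
  define r where "r = entries I"
  interpret scaled_input n K z "\<lambda>e. fst (quotient_of (r ! e))" "\<lambda>e. snd (quotient_of (r ! e))"
    unfolding n_def K_def z_def r_def by (rule encode_inst_scaled_input[OF I])
  let ?s = "input_store (encode_inst I)"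
  have len: "length r = m"
    unfolding m_def unfolding r_def n_def K_def by (rule length_entries)
  have entry: "j < n \<Longrightarrow> r ! j = weight I j" "i < K \<Longrightarrow> r ! (n + i) = prob I i"
    "i < K \<Longrightarrow> j < n \<Longrightarrow> r ! (n + K + (i * n + j)) = due I i j" for i j
    unfolding r_def n_def K_def by (rule entries_nth; assumption)+
  have enc: "encode_inst I = int n # int K # concat (map encode_rat r)"
    by (simp add: encode_inst_eq n_def K_def r_def)
  have len_enc: "length (encode_inst I) = 2 * m + 2"
    by (simp add: enc length_concat_encode_rat len)
  have "length (encode_inst I) \<le> z" unfolding z_def by (rule length_le_input_size)
  then have bounded: "bounded_store L ?s"
    using le_L Z_le_L(2)[unfolded Z_def] by (intro bounded_input_store) (simp_all add: z_def)
  have stored: "input_stored ?s"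
    unfolding input_stored_def
  proof (intro conjI allI impI)
    show "?s 0 1 = int n" "?s 0 2 = int K" by (simp_all add: input_store_def enc)
    fix e assume e: "e < m"
    have idx: "nat (2 * int e + 3 - 1) = Suc (Suc (2 * e))" "nat (2 * int e + 4 - 1) = Suc (Suc (2 * e + 1))"
      by simp_all
    have "2 * int e + 4 \<le> int (length (encode_inst I))" using e len_enc by simp
    then have "?s 0 (2 * int e + 3) = encode_inst I ! nat (2 * int e + 3 - 1)"
      "?s 0 (2 * int e + 4) = encode_inst I ! nat (2 * int e + 4 - 1)"
      by (simp_all add: input_store_def)
    then show "?s 0 (2 * int e + 3) = fst (quotient_of (r ! e))"
      "?s 0 (2 * int e + 4) = snd (quotient_of (r ! e))"
      unfolding idx enc using nth_concat_encode_rat[of e r] e len by simp_all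
  qed
  have zero: "?s x i = 0" if "0 < x" for x i using that by (simp add: input_store_def)
  obtain t s \<mu> where run: "exec (program unit) ?s t s" "t \<le> time_bound N (int_size L) (program unit)"
    and \<mu>: "bij_betw \<mu> {..<n} {..<n}" "has_output s (map int (map \<mu> [0..<n]))"
    and opt: "\<forall>\<sigma>. bij_betw \<sigma> {..<n} {..<n} \<longrightarrow>
      (\<Sum>q<n. cost unit q (\<mu> q)) \<le> (\<Sum>q<n. cost unit q (\<sigma> q))"
    using program_correct[OF stored zero, of unit] bounded unfolding wp_def by auto
  have "L = 2 ^ (5 * z + 2)" by (simp add: L_def Z_def power_add power_mult mult.commute[of 5])
  then have "int_size L = 5 * z + 4" by (simp only: int_size_power2)
  with run(2) have time: "t \<le> time_bound ((z + 1)\<^sup>2) (5 * z + 4) (program unit)"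
    by (simp add: N_def)
  define D :: rat where "D = of_int (Q m)"
  \<comment> \<open>One factor \<open>D\<close> comes from the weight, one from the probability, and
    a third from the tardiness; the unit penalty is not scaled.\<close>
  define \<gamma> where "\<gamma> = D\<^sup>2 * (if unit then 1 else D)"
  have D: "0 < D" using Q_m_pos by (simp add: D_def)
  then have \<gamma>: "0 < \<gamma>" by (simp add: \<gamma>_def)
  have Qr: "of_int (Q e) = r ! e * D" if "e < m" for e
  proof -
    obtain a b where ab: "quotient_of (r ! e) = (a, b)" by fastforce
    then have b: "0 < b" and r: "r ! e = of_int a / of_int b"
      using quotient_of_denom_pos quotient_of_div by auto
    have "of_int (Q e) * of_int b = of_int a * D"
      using Q_eq[OF that] ab unfolding D_def by (simp flip: of_int_mult)
    then have "of_int (Q e) = of_int a * D / of_int b" using b by (simp add: nonzero_eq_divide_eq)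
    then show ?thesis by (simp add: r)
  qed
  have pen: "of_int (penalty unit t i j) =
      lateness_penalty unit (of_nat t + 1) (due I i j) * (if unit then 1 else D)"
    if "i < K" "j < n" for t i j
  proof -
    have "i * n + j < (i + 1) * n" using \<open>j < n\<close> by simp
    also have "\<dots> \<le> K * n" using that(1) by (intro mult_right_mono) auto
    finally have "n + K + (i * n + j) < m" by (simp add: m_def mult.commute)
    from Qr[OF this] have q: "of_int (Q (n + K + (i * n + j))) = due I i j * D"
      using that by (simp add: entry)
    \<comment> \<open>Scaling by the positive \<open>D\<close> does not affect which jobs are
      late.\<close>
    have "Q (n + K + (i * n + j)) < (int t + 1) * Q m \<longleftrightarrow>
        (of_int (Q (n + K + (i * n + j))) :: rat) < of_int ((int t + 1) * Q m)"
      by (simp only: of_int_less_iff)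
    also have "\<dots> \<longleftrightarrow> due I i j * D < (of_nat t + 1) * D" by (simp add: q D_def)
    also have "\<dots> \<longleftrightarrow> due I i j < of_nat t + 1" using D by simp
    finally show ?thesis
      by (simp add: penalty_def lateness_penalty_def Let_def q left_diff_distrib flip: D_def)
  qed
  have cost: "of_int (cost unit t j) = \<gamma> * (weight I j *
      (\<Sum>i<K. prob I i * lateness_penalty unit (of_nat t + 1) (due I i j)))" if "j < n" for t j
  proof -
    have "of_int (Q j) = weight I j * D"
      using Qr[of j] that by (simp add: m_def entry)
    moreover have "of_int (Q (n + i)) = prob I i * D" if "i < K" for i
      using Qr[of "n + i"] that by (simp add: m_def entry)
    ultimately show ?thesis
      using that
      by (simp add: cost_def pen \<gamma>_def sum_distrib_left sum_distrib_right power2_eq_square mult_ac)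
  qed
  have total: "\<gamma> * expected_cost (objective unit) I \<pi> = of_int (\<Sum>t<n. cost unit t (\<pi> ! t))"
    if "\<pi> \<in> schedules I" for \<pi>
    using bij_betwE[OF schedules_nth_bij(3)[OF that]]
    by (simp add: expected_cost_eq[OF that] sum_distrib_left cost flip: n_def K_def)
  define y where "y = map \<mu> [0..<n]"
  have y: "y \<in> schedules I"
    using \<mu>(1) by (auto simp: y_def schedules_def permutations_of_set_def distinct_map
        bij_betw_def atLeast0LessThan simp flip: n_def)
  have "expected_cost (objective unit) I y \<le> expected_cost (objective unit) I \<pi>"
    if "\<pi> \<in> schedules I" for \<pi>
  proof -
    have "(\<Sum>t<n. cost unit t (y ! t)) \<le> (\<Sum>t<n. cost unit t (\<pi> ! t))"
      using opt[rule_format, of "nth \<pi>"] schedules_nth_bij(3)[OF that] by (simp add: y_def flip: n_def)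
    then have "\<gamma> * expected_cost (objective unit) I y \<le> \<gamma> * expected_cost (objective unit) I \<pi>"
      unfolding total[OF y] total[OF that] by (simp only: of_int_le_iff)
    then show ?thesis using \<gamma> by simp
  qed
  with y have "min_exp (objective unit) I y"
    by (auto simp: min_exp_def is_arg_min_def not_less)
  with run(1) time \<mu>(2) show ?thesis unfolding encode_schedule_def y_def by blast
qed

theorem theorem9:
  shows "\<forall>f \<in> {sum_wU, sum_wT}.
    polynomially_solvable sched_instances (min_exp f) encode_inst encode_schedule"
proof -
  have "polynomially_solvable sched_instances (min_exp (objective unit)) encode_inst encode_schedule"
    for unit
  proof -
    obtain p where p: "time_bound ((z + 1)\<^sup>2) (5 * z + 4) (program unit) = poly p z" for z
      \<comment> \<open>The two polynomials are \<open>(z + 1)\<^sup>2\<close>, the iteration bound,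
        and \<open>5 * z + 4\<close>, the size of \<open>L\<close>.\<close>
      using time_bound_poly[of "[:1, 1:]\<^sup>2" "[:4, 5:]" "program unit"]
      by (auto simp: algebra_simps)
    show ?thesis
      unfolding polynomially_solvable_def
      using program_solves[of _ unit] unfolding p by blast
  qed
  from this[of True] this[of False] show ?thesis by (simp add: objective_def)
qed

end
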